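(* Let $a>b>0$, $c^2=a^2-b^2$, let $\mathcal{E}$ be the ellipse $x^2/a^2+y^2/b^2=1$, and let $C=[x_c,y_c]$ be a point interior to $\mathcal{E}$. Let $\mathcal{T}_\circ$ be the Poncelet family of triangles inscribed in $\mathcal{E}$ and circumscribing a circle centered at $C$, and let $\mathcal{L}_5$ be the (elliptic) locus of the Euler center $X_5$ over $\mathcal{T}_\circ$. Then one focus $F_5$ of $\mathcal{L}_5$ is at $C=[x_c,y_c]$ and the other, $F_5'$, is given by \[ F_5'=\left[x_c\,\frac{1+(b/a)^2}{2},\;y_c\,\frac{1+(a/b)^2}{2}\right]. \] Furthermore, the semi-axis lengths $a_5$ (major) and $b_5$ (minor) of $\mathcal{L}_5$ are given by \[ a_5=\frac{(a^5+3a^3b^2)\,\delta_3-(b^5+3a^2b^3)\,\delta_3'}{abc^2},\qquad b_5=\frac{(3a^3+ab^2)\,\delta_3-(3b^3+a^2b)\,\delta_3'}{c^2}, \] where $\delta_3=\frac{\sqrt{b^4+c^2y_c^2}}{2b}$ and $\delta_3'=\frac{\sqrt{a^4-c^2x_c^2}}{2a}$.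
   Context: For each point $C=[x_c,y_c]$ interior to $\mathcal{E}$ there is a circle $\mathcal{K}$ centered at $C$, nested in $\mathcal{E}$, admitting triangles inscribed in $\mathcal{E}$ with all sides tangent to $\mathcal{K}$; its radius is $r=\big(b\sqrt{a^4-c^2x_c^2}-a\sqrt{b^4+c^2y_c^2}\big)/c^2$. By Poncelet's porism every point of $\mathcal{E}$ is then a vertex of such a triangle. $\mathcal{T}_\circ$ is the one-parameter family of all these triangles; $\mathcal{K}$ is their common incircle. The locus $\mathcal{L}_5$ is the curve swept by $X_5$ as the triangle ranges over $\mathcal{T}_\circ$. The Euler center $X_5$ is the center of the nine-point circle, i.e. the midpoint of the circumcenter and the orthocenter. It is known that $\mathcal{L}_5$ is an ellipse, since $X_5$ is a fixed linear combination of the barycenter and the circumcenter.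
   Formalization: The printed denominators 2b, 2a of δ3, δ3' make the claim false (at C=0 the foci coincide but a5≠b5); both are corrected to 4ab, and b5 is the absolute value of the displayed expression, which may be negative, or zero when the locus is the segment between the foci. *)

theory Defs
  imports "HOL-Analysis.Analysis"
begin

text \<open>Points of the Euclidean plane are pairs of reals; \<open>dist\<close> on \<^typ>\<open>real \<times> real\<close> is the
  Euclidean distance.\<close>

definition std_ellipse :: "real \<Rightarrow> real \<Rightarrow> (real \<times> real) set" where
  "std_ellipse a b = {(x, y). x\<^sup>2 / a\<^sup>2 + y\<^sup>2 / b\<^sup>2 = 1}"

text \<open>Tangency of a side: the line \<open>PQ\<close> meets the circle in exactly one point, and that point lies
  on the side itself. A circle tangent in this sense to all three sides is the incircle;
  excircles are excluded.\<close>

definition side_tangent :: "real \<times> real \<Rightarrow> real \<times> real \<Rightarrow> real \<times> real \<Rightarrow> real \<Rightarrow> bool" where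
  "side_tangent P Q C r \<longleftrightarrow>
     (\<exists>T \<in> closed_segment P Q. affine hull {P, Q} \<inter> sphere C r = {T})"

definition poncelet_triangles ::
  "real \<Rightarrow> real \<Rightarrow> real \<times> real \<Rightarrow> real \<Rightarrow> ((real \<times> real) \<times> (real \<times> real) \<times> (real \<times> real)) set" where
  "poncelet_triangles a b C r =
     {(P, Q, R). \<not> collinear {P, Q, R} \<and> {P, Q, R} \<subseteq> std_ellipse a b \<and>
        side_tangent P Q C r \<and> side_tangent Q R C r \<and> side_tangent R P C r}"

definition circumcenter :: "real \<times> real \<Rightarrow> real \<times> real \<Rightarrow> real \<times> real \<Rightarrow> real \<times> real" where
  "circumcenter P Q R = (THE X. dist X P = dist X Q \<and> dist X Q = dist X R)"

definition orthocenter :: "real \<times> real \<Rightarrow> real \<times> real \<Rightarrow> real \<times> real \<Rightarrow> real \<times> real" where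
  "orthocenter P Q R =
     (THE H. (H - P) \<bullet> (Q - R) = 0 \<and> (H - Q) \<bullet> (R - P) = 0 \<and> (H - R) \<bullet> (P - Q) = 0)"

definition euler_center :: "real \<times> real \<Rightarrow> real \<times> real \<Rightarrow> real \<times> real \<Rightarrow> real \<times> real" where
  "euler_center P Q R = midpoint (circumcenter P Q R) (orthocenter P Q R)"

definition euler_locus :: "real \<Rightarrow> real \<Rightarrow> real \<times> real \<Rightarrow> real \<Rightarrow> (real \<times> real) set" where
  "euler_locus a b C r = {euler_center P Q R | P Q R. (P, Q, R) \<in> poncelet_triangles a b C r}"

text \<open>\<open>S\<close> is the ellipse with foci \<open>F\<close>, \<open>F'\<close>, semi-major axis \<open>A\<close> and semi-minor axis \<open>B\<close>.
  The value \<open>B = 0\<close> is admitted, and then \<open>S\<close> is the segment between the foci. This case does occur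
  for the locus of the Euler center: whenever the family contains an equilateral triangle, that
  triangle has its Euler center at \<open>C\<close>, so the focus \<open>C\<close> lies on the locus.\<close>

definition ellipse_foci_axes ::
  "(real \<times> real) set \<Rightarrow> real \<times> real \<Rightarrow> real \<times> real \<Rightarrow> real \<Rightarrow> real \<Rightarrow> bool" where
  "ellipse_foci_axes S F F' A B \<longleftrightarrow>
     0 < A \<and> 0 \<le> B \<and> A\<^sup>2 = B\<^sup>2 + (dist F F' / 2)\<^sup>2 \<and> S = {P. dist P F + dist P F' = 2 * A}"

text \<open>The quantities \<open>\<delta>\<^sub>3\<close> and \<open>\<delta>\<^sub>3'\<close> of the semi-axis formulas. The source prints the denominators
  \<open>2 b\<close> and \<open>2 a\<close>, which contradict its own foci: for \<open>C\<close> at the origin the foci coincide, yet the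
  printed semi-axes would be \<open>(a\<^sup>2 + b\<^sup>2) / 2\<close> and \<open>a b\<close>. The denominator \<open>4 a b\<close> in both is what the
  printed semi-axis formulas require. With it, the formula for the semi-minor axis still
  carries a sign (negative for \<open>C\<close> near the origin, zero when the family contains an equilateral
  triangle), so it has to be taken in absolute value.\<close>

definition delta3 :: "real \<Rightarrow> real \<Rightarrow> real \<Rightarrow> real" where
  "delta3 a b y = sqrt (b ^ 4 + (a\<^sup>2 - b\<^sup>2) * y\<^sup>2) / (4 * a * b)"

definition delta3' :: "real \<Rightarrow> real \<Rightarrow> real \<Rightarrow> real" where
  "delta3' a b x = sqrt (a ^ 4 - (a\<^sup>2 - b\<^sup>2) * x\<^sup>2) / (4 * a * b)"

end

theory Submission
  imports Defs "HOL-Computational_Algebra.Fundamental_Theorem_Algebra"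
begin

text \<open>Write the vertices as \<open>(a Re z\<^sub>k, b Im z\<^sub>k)\<close> with \<open>|z\<^sub>k| = 1\<close>. This affine map turns the
  incircle into an ellipse with foci \<open>f, g\<close> inside the unit disc, and the triples \<open>(z\<^sub>1, z\<^sub>2, z\<^sub>3)\<close> become
  the fibres over the unit circle of the Blaschke product \<open>z (z - f) (z - g) / ((1 - cnj f z) (1 - cnj g z))\<close>.
  So \<open>z\<^sub>1 + z\<^sub>2 + z\<^sub>3 = f + g + cnj (f g) l\<close> where \<open>l = z\<^sub>1 z\<^sub>2 z\<^sub>3\<close> runs through the whole unit circle. The
  Euler center depends real-linearly on \<open>z\<^sub>1 + z\<^sub>2 + z\<^sub>3\<close> and \<open>l\<close>, hence equals a constant plus
  \<open>m l + n cnj l\<close>; the latter sweeps the ellipse with foci \<open>\<plusminus> 2 sqrt (m n)\<close> and semi-axes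
  \<open>|m| + |n|\<close> and \<open>||m| - |n||\<close>.\<close>

section \<open>Ellipses as images of the unit circle\<close>

lemma cmod_parallelogram: "(cmod (x + y))\<^sup>2 + (cmod (x - y))\<^sup>2 = 2 * ((cmod x)\<^sup>2 + (cmod y)\<^sup>2)"
  by (simp add: cmod_power2) algebra

lemma unit_circle_image_eq_ellipse:
  fixes m n w v :: complex
  assumes w: "w\<^sup>2 = 4 * m * n"
  shows "cmod (v - w) + cmod (v + w) = 2 * (cmod m + cmod n) \<longleftrightarrow>
    (\<exists>l. cmod l = 1 \<and> v = m * l + n * cnj l)"
proof -
  \<comment> \<open>With \<open>m = \<mu>\<^sup>2\<close>, \<open>n = \<nu>\<^sup>2\<close>, \<open>l = \<omega>\<^sup>2\<close>, \<open>w = 2 \<mu> \<nu>\<close> one has \<open>v \<plusminus> w = (\<mu> \<omega> \<plusminus> \<nu> cnj \<omega>)\<^sup>2\<close>, so the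
    sum of the focal distances is given by the parallelogram law.\<close>
  obtain \<mu> where \<mu>: "\<mu>\<^sup>2 = m" by (metis power2_csqrt)
  obtain \<nu>' where \<nu>': "\<nu>'\<^sup>2 = n" by (metis power2_csqrt)
  have "w\<^sup>2 = (2 * \<mu> * \<nu>')\<^sup>2" using w \<mu> \<nu>' by (simp add: power_mult_distrib)
  then have "w = 2 * \<mu> * \<nu>' \<or> w = - (2 * \<mu> * \<nu>')" using power2_eq_iff by blast
  \<comment> \<open>The sign of a square root of \<open>n\<close> is free; it is chosen to match
    \<open>w\<close>.\<close>
  then obtain \<nu> where \<nu>: "\<nu>\<^sup>2 = n" and w2: "w = 2 * \<mu> * \<nu>"
    using \<nu>' by (metis mult_minus_right power2_minus)
  have norms: "cmod m = (cmod \<mu>)\<^sup>2" "cmod n = (cmod \<nu>)\<^sup>2"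
    using \<mu> \<nu> by (auto simp: norm_power)
  show ?thesis
  proof
    assume sum: "cmod (v - w) + cmod (v + w) = 2 * (cmod m + cmod n)"
    obtain \<alpha> where \<alpha>: "\<alpha>\<^sup>2 = v + w" by (metis power2_csqrt)
    obtain \<beta> where \<beta>: "\<beta>\<^sup>2 = v - w" by (metis power2_csqrt)
    \<comment> \<open>\<open>x\<close> and \<open>y\<close> are to become
      \<open>\<mu> * \<omega>\<close> and \<open>\<nu> * cnj \<omega>\<close>, whose sum and
      difference have squares \<open>v + w\<close> and \<open>v - w\<close>.\<close>
    define x where "x = (\<alpha> + \<beta>) / 2"
    define y where "y = (\<alpha> - \<beta>) / 2"
    have xy: "x + y = \<alpha>" "x - y = \<beta>" by (simp_all add: x_def y_def field_simps)
    have v: "v = x\<^sup>2 + y\<^sup>2" and prod: "x * y = \<mu> * \<nu>"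
      using \<alpha> \<beta> w2 unfolding xy[symmetric] by algebra+
    have s: "(cmod x)\<^sup>2 + (cmod y)\<^sup>2 = (cmod \<mu>)\<^sup>2 + (cmod \<nu>)\<^sup>2"
    proof -
      have "(cmod (x + y))\<^sup>2 + (cmod (x - y))\<^sup>2 = cmod (v + w) + cmod (v - w)"
        unfolding xy by (metis \<alpha> \<beta> norm_power)
      then show ?thesis using sum cmod_parallelogram[of x y] norms by simp
    qed
    have q: "cmod x * cmod y = cmod \<mu> * cmod \<nu>"
      using prod by (metis norm_mult)
    \<comment> \<open>The squared moduli of \<open>x\<close>, \<open>y\<close> have the same sum and
      product as those of \<open>\<mu>\<close>, \<open>\<nu>\<close>, so the two pairs agree up to
      order. Exchanging \<open>x\<close> and \<open>y\<close> changes neither \<open>v\<close> nor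
      the product.\<close>
    have "((cmod x)\<^sup>2 - (cmod \<mu>)\<^sup>2) * ((cmod x)\<^sup>2 - (cmod \<nu>)\<^sup>2) = 0"
      using s q by algebra
    then have "(cmod x)\<^sup>2 = (cmod \<mu>)\<^sup>2 \<or> (cmod y)\<^sup>2 = (cmod \<mu>)\<^sup>2" using s by auto
    then have "cmod x = cmod \<mu> \<or> cmod y = cmod \<mu>" by simp
    then obtain x' y' where v': "v = x'\<^sup>2 + y'\<^sup>2" and p': "x' * y' = \<mu> * \<nu>"
      and nx: "cmod x' = cmod \<mu>" and ny: "(cmod x')\<^sup>2 + (cmod y')\<^sup>2 = (cmod \<mu>)\<^sup>2 + (cmod \<nu>)\<^sup>2"
      using v prod s by (metis add.commute mult.commute)
    have ny': "cmod y' = cmod \<nu>" using nx ny by simp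
    obtain \<omega> where \<omega>: "cmod \<omega> = 1" "x' = \<mu> * \<omega>" "y' = \<nu> * cnj \<omega>"
    proof (cases "\<mu> = 0")
      case False
      have 1: "cmod (x' / \<mu>) = 1" using False nx by (simp add: norm_divide)
      have "(x' / \<mu>) * cnj (x' / \<mu>) = 1"
        by (metis 1 complex_norm_square of_real_1 one_power2)
      then have "y' = \<nu> * cnj (x' / \<mu>)"
        using False p' nx by (smt (verit, ccfv_threshold) mult.assoc mult.commute mult.left_neutral nonzero_mult_div_cancel_left times_divide_eq_right)
      then show ?thesis using that[of "x' / \<mu>"] 1 False by simp
    next
      case True
      then have x0: "x' = 0" using nx by simp
      show ?thesis
      proof (cases "\<nu> = 0")
        case False
        then show ?thesis using that[of "cnj (y' / \<nu>)"] True x0 ny' by (simp add: norm_divide)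
      next
        case 2: True
        then show ?thesis using that[of 1] True x0 ny' by simp
      qed
    qed
    have "v = m * \<omega>\<^sup>2 + n * cnj (\<omega>\<^sup>2)"
      using v' \<omega> \<mu> \<nu> by (simp add: power_mult_distrib)
    moreover have "cmod (\<omega>\<^sup>2) = 1" using \<omega> by (simp add: norm_power)
    ultimately show "\<exists>l. cmod l = 1 \<and> v = m * l + n * cnj l" by blast
  next
    assume "\<exists>l. cmod l = 1 \<and> v = m * l + n * cnj l"
    then obtain l where l: "cmod l = 1" and v: "v = m * l + n * cnj l" by blast
    obtain \<omega> where \<omega>: "\<omega>\<^sup>2 = l" by (metis power2_csqrt)
    have n1: "cmod \<omega> = 1" using l \<omega> by (metis norm_power norm_ge_zero power2_eq_1_iff
        abs_norm_cancel power2_eq_iff_nonneg zero_le_one one_power2)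
    then have c: "\<omega> * cnj \<omega> = 1" by (metis complex_norm_square of_real_1 one_power2)
    have v': "v = (\<mu> * \<omega>)\<^sup>2 + (\<nu> * cnj \<omega>)\<^sup>2"
      using v \<mu> \<nu> \<omega> by (auto simp: power_mult_distrib)
    have "v + w = (\<mu> * \<omega> + \<nu> * cnj \<omega>)\<^sup>2" "v - w = (\<mu> * \<omega> - \<nu> * cnj \<omega>)\<^sup>2"
      using v' w2 c by algebra+
    then have "cmod (v - w) + cmod (v + w) =
        (cmod (\<mu> * \<omega> + \<nu> * cnj \<omega>))\<^sup>2 + (cmod (\<mu> * \<omega> - \<nu> * cnj \<omega>))\<^sup>2"
      by (simp add: norm_power)
    also have "\<dots> = 2 * (cmod m + cmod n)"
      unfolding cmod_parallelogram using n1 norms by (simp add: norm_mult)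
    finally show "cmod (v - w) + cmod (v + w) = 2 * (cmod m + cmod n)" .
  qed
qed

section \<open>Triangles in the plane\<close>

lemma collinear_iff_cross:
  fixes P Q R :: "real \<times> real"
  shows "collinear {P, Q, R} \<longleftrightarrow>
    (fst Q - fst P) * (snd R - snd P) = (snd Q - snd P) * (fst R - fst P)"
proof -
  have "collinear {P, Q, R} = collinear {Q, P, R}" by (simp add: insert_commute)
  also have "\<dots> \<longleftrightarrow> Q - P = 0 \<or> R - P = 0 \<or> (\<exists>k. R - P = k *\<^sub>R (Q - P))"
    using collinear_3[of Q P R] collinear_lemma[of "Q - P" "R - P"] by (simp add: NO_MATCH_def)
  also have "\<dots> \<longleftrightarrow> (fst Q - fst P) * (snd R - snd P) = (snd Q - snd P) * (fst R - fst P)"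
    (is "?l \<longleftrightarrow> ?r")
  proof
    assume ?r
    show ?l
    proof (cases "fst Q = fst P")
      case False
      then have "snd R - snd P = (fst R - fst P) / (fst Q - fst P) * (snd Q - snd P)"
        using \<open>?r\<close> by (simp add: nonzero_eq_divide_eq mult.commute)
      then have "R - P = ((fst R - fst P) / (fst Q - fst P)) *\<^sub>R (Q - P)"
        using False by (simp add: prod_eq_iff)
      then show ?thesis by blast
    next
      case True
      show ?thesis
      proof (cases "snd Q = snd P")
        case False
        then have "fst R = fst P" using \<open>?r\<close> unfolding True by simp
        then have "R - P = ((snd R - snd P) / (snd Q - snd P)) *\<^sub>R (Q - P)"
          using False True by (simp add: prod_eq_iff)
        then show ?thesis by blast
      qed (use True in \<open>simp add: prod_eq_iff\<close>)
    qed
  qed (auto simp: prod_eq_iff)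
  finally show ?thesis .
qed

text \<open>Subtracting the squared distances cancels the quadratic term in \<open>X\<close>, so
  equidistance becomes a linear condition.\<close>

lemma dist_eq_iff_inner:
  fixes X P Q :: "'a :: real_inner"
  shows "dist X P = dist X Q \<longleftrightarrow> 2 * (X \<bullet> (P - Q)) = P \<bullet> P - Q \<bullet> Q"
proof -
  have "dist X P = dist X Q \<longleftrightarrow> (X - P) \<bullet> (X - P) = (X - Q) \<bullet> (X - Q)"
    by (simp add: dist_norm norm_eq)
  also have "\<dots> \<longleftrightarrow> 2 * (X \<bullet> (P - Q)) = P \<bullet> P - Q \<bullet> Q"
    by (auto simp: inner_diff inner_commute algebra_simps)
  finally show ?thesis .
qed

text \<open>Two sides of a proper triangle span the plane. This gives the uniqueness behind both
  \<open>THE\<close> definitions.\<close>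

lemma noncollinear_inner_unique:
  fixes P Q R X :: "real \<times> real"
  assumes "\<not> collinear {P, Q, R}" "X \<bullet> (P - Q) = 0" "X \<bullet> (Q - R) = 0"
  shows "X = 0"
proof -
  let ?D = "(fst Q - fst P) * (snd R - snd P) - (snd Q - snd P) * (fst R - fst P)"
  have D: "?D \<noteq> 0" using assms(1) unfolding collinear_iff_cross by simp
  have "fst X * (fst P - fst Q) + snd X * (snd P - snd Q) = 0"
    "fst X * (fst Q - fst R) + snd X * (snd Q - snd R) = 0"
    using assms(2,3) by (auto simp: inner_prod_def)
  then have "fst X * ?D = 0" "snd X * ?D = 0" by algebra+
  then show ?thesis using D by (simp add: prod_eq_iff)
qed

lemma circumcenter_eq:
  assumes nc: "\<not> collinear {P, Q, R}" and "dist Z P = dist Z Q" "dist Z Q = dist Z R"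
  shows "circumcenter P Q R = Z"
  unfolding circumcenter_def
proof (rule the_equality)
  fix X assume "dist X P = dist X Q \<and> dist X Q = dist X R"
  then have "(X - Z) \<bullet> (P - Q) = 0" "(X - Z) \<bullet> (Q - R) = 0"
    using assms(2,3) unfolding dist_eq_iff_inner by (simp_all add: inner_diff_left)
  then show "X = Z" using noncollinear_inner_unique[OF nc] by fastforce
qed (use assms in simp)

text \<open>Seen from the circumcenter \<open>Z\<close> the vertices have equal length, and the
  orthocenter is the sum of the three vectors. Its difference from \<open>P\<close> is
  \<open>(Q - Z) + (R - Z)\<close>, which is orthogonal to \<open>Q - R\<close>.\<close>

lemma orthocenter_eq:
  assumes nc: "\<not> collinear {P, Q, R}" and "dist Z P = dist Z Q" "dist Z Q = dist Z R"
  shows "orthocenter P Q R = P + Q + R - 2 *\<^sub>R Z"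
  unfolding orthocenter_def
proof (rule the_equality)
  have e: "2 * (Z \<bullet> (P - Q)) = P \<bullet> P - Q \<bullet> Q" "2 * (Z \<bullet> (Q - R)) = Q \<bullet> Q - R \<bullet> R"
    using assms(2,3) unfolding dist_eq_iff_inner by simp_all
  then show H: "(P + Q + R - 2 *\<^sub>R Z - P) \<bullet> (Q - R) = 0 \<and> (P + Q + R - 2 *\<^sub>R Z - Q) \<bullet> (R - P) = 0 \<and>
      (P + Q + R - 2 *\<^sub>R Z - R) \<bullet> (P - Q) = 0"
    by (simp add: inner_diff inner_add inner_commute algebra_simps)
  fix X assume X: "(X - P) \<bullet> (Q - R) = 0 \<and> (X - Q) \<bullet> (R - P) = 0 \<and> (X - R) \<bullet> (P - Q) = 0"
  have "(X - (P + Q + R - 2 *\<^sub>R Z)) \<bullet> (P - Q) = 0"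
    "(X - (P + Q + R - 2 *\<^sub>R Z)) \<bullet> (Q - R) = 0"
    using X H by (simp_all only: inner_diff_left) linarith+
  then show "X = P + Q + R - 2 *\<^sub>R Z" using noncollinear_inner_unique[OF nc] by fastforce
qed

lemma euler_center_eq:
  assumes "\<not> collinear {P, Q, R}" and "dist Z P = dist Z Q" "dist Z Q = dist Z R"
  shows "euler_center P Q R = (1/2) *\<^sub>R (P + Q + R - Z)"
  unfolding euler_center_def circumcenter_eq[OF assms] orthocenter_eq[OF assms] midpoint_def
  by (simp add: prod_eq_iff)

section \<open>Tangency of a side as a vanishing discriminant\<close>

lemma norm_sq_line:
  fixes P d C :: "'a :: real_inner"
  shows "(norm (P + t *\<^sub>R d - C))\<^sup>2 = (d \<bullet> d) * t\<^sup>2 - 2 * t * (d \<bullet> (C - P)) + (C - P) \<bullet> (C - P)"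
  unfolding power2_norm_eq_inner
  by (simp add: inner_diff inner_add inner_commute power2_eq_square algebra_simps)

lemma affine_hull_pair_line: "X \<in> affine hull {P, Q} \<longleftrightarrow> (\<exists>t. X = P + t *\<^sub>R (Q - P))"
  by (auto simp: affine_hull_2_alt)

text \<open>With \<open>k = d \<bullet> d\<close>, \<open>e = d \<bullet> (C - P)\<close> and
  \<open>w\<close> the squared length of \<open>C - P\<close>, the second assumption says that the
  line parameter \<open>t\<close> gives a point of the circle. The first places \<open>t\<close> at
  the vertex of the parabola. The next two lemmas concern the same quadratic.\<close>

lemma quadratic_double_root:
  fixes k t e w r :: real
  assumes "k * t = e" "k * t\<^sup>2 - 2 * t * e + w = r\<^sup>2"
  shows "e\<^sup>2 = k * (w - r\<^sup>2)"
  using arg_cong[OF assms(2), of "\<lambda>x. k * x"] unfolding assms(1)[symmetric]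
  by (simp add: power2_eq_square algebra_simps)

lemma quadratic_other_root:
  fixes k t t' e w r :: real
  assumes "k * (t' + t) = 2 * e" "k * t\<^sup>2 - 2 * t * e + w = r\<^sup>2"
  shows "k * t'\<^sup>2 - 2 * t' * e + w = r\<^sup>2"
  using assms by algebra

lemma quadratic_complete_square:
  fixes k t e w r :: real
  assumes "e\<^sup>2 = k * (w - r\<^sup>2)"
  shows "(k * t - e)\<^sup>2 = k * (k * t\<^sup>2 - 2 * t * e + w) - k * r\<^sup>2"
  using assms by algebra

text \<open>The other root of the quadratic also gives a common point of line and circle; as there
  is only one such point, the roots coincide and the discriminant vanishes.\<close>

lemma side_tangent_imp:
  assumes "P \<noteq> Q" "side_tangent P Q C r"
  shows "((Q - P) \<bullet> (C - P))\<^sup>2 = ((Q - P) \<bullet> (Q - P)) * ((C - P) \<bullet> (C - P) - r\<^sup>2)"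
proof -
  let ?d = "Q - P" let ?k = "?d \<bullet> ?d" let ?e = "?d \<bullet> (C - P)"
  have k: "?k > 0" using assms(1) by simp
  obtain T where T: "affine hull {P, Q} \<inter> sphere C r = {T}"
    using assms(2) unfolding side_tangent_def by blast
  then have Tin: "T \<in> affine hull {P, Q}" and Ts: "T \<in> sphere C r" by auto
  obtain t where t: "T = P + t *\<^sub>R ?d" using Tin unfolding affine_hull_pair_line by blast
  have "norm (T - C) = r" using Ts by (simp add: dist_norm norm_minus_commute)
  then have eq: "?k * t\<^sup>2 - 2 * t * ?e + (C - P) \<bullet> (C - P) = r\<^sup>2"
    unfolding t using norm_sq_line[of P t ?d C] by simp
  \<comment> \<open>The roots of the quadratic add up to \<open>2 * ?e / ?k\<close>.\<close>
  define t' where "t' = 2 * ?e / ?k - t"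
  have "?k * (t' + t) = 2 * ?e" unfolding t'_def using k by simp
  then have "?k * t'\<^sup>2 - 2 * t' * ?e + (C - P) \<bullet> (C - P) = r\<^sup>2"
    using eq by (rule quadratic_other_root)
  then have "(norm (P + t' *\<^sub>R ?d - C))\<^sup>2 = r\<^sup>2" unfolding norm_sq_line .
  moreover have "r \<ge> 0" using Ts by auto
  ultimately have "P + t' *\<^sub>R ?d \<in> sphere C r"
    by (simp add: dist_norm norm_minus_commute)
  then have "P + t' *\<^sub>R ?d \<in> affine hull {P, Q} \<inter> sphere C r"
    unfolding affine_hull_pair_line Int_iff by blast
  then have "t' = t" unfolding T t using assms(1) by auto
  then have "?k * t = ?e" using \<open>?k * (t' + t) = 2 * ?e\<close> by simp
  then show ?thesis using eq by (rule quadratic_double_root)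
qed

text \<open>The vanishing discriminant makes the contact point unique; \<open>seg\<close> puts it on
  the side itself and so rules out an excircle.\<close>

lemma side_tangentI:
  assumes ne: "P \<noteq> Q" and r: "r \<ge> 0"
    and eq: "((Q - P) \<bullet> (C - P))\<^sup>2 = ((Q - P) \<bullet> (Q - P)) * ((C - P) \<bullet> (C - P) - r\<^sup>2)"
    and seg: "\<And>t. norm (P + t *\<^sub>R (Q - P) - C) = r \<Longrightarrow> 0 \<le> t \<and> t \<le> 1"
  shows "side_tangent P Q C r"
proof -
  let ?d = "Q - P" let ?k = "?d \<bullet> ?d" let ?e = "?d \<bullet> (C - P)"
  have k: "?k > 0" using ne by simp
  have iff: "norm (P + t *\<^sub>R ?d - C) = r \<longleftrightarrow> t = ?e / ?k" for t
  proof -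
    have "norm (P + t *\<^sub>R ?d - C) = r \<longleftrightarrow> (norm (P + t *\<^sub>R ?d - C))\<^sup>2 = r\<^sup>2" using r by simp
    also have "\<dots> \<longleftrightarrow> ?k * (?k * t\<^sup>2 - 2 * t * ?e + (C - P) \<bullet> (C - P)) = ?k * r\<^sup>2"
      unfolding norm_sq_line using k by simp
    also have "\<dots> \<longleftrightarrow> (?k * t - ?e)\<^sup>2 = 0"
    proof -
      have "(?k * t - ?e)\<^sup>2 = ?k * (?k * t\<^sup>2 - 2 * t * ?e + (C - P) \<bullet> (C - P)) - ?k * r\<^sup>2"
        using eq by (rule quadratic_complete_square)
      then show ?thesis by simp
    qed
    also have "\<dots> \<longleftrightarrow> t = ?e / ?k" using k by (auto simp: field_simps)
    finally show ?thesis .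
  qed
  let ?T = "P + (?e / ?k) *\<^sub>R ?d"
  have "0 \<le> ?e / ?k \<and> ?e / ?k \<le> 1" using seg iff by blast
  then have "?T \<in> closed_segment P Q"
    unfolding closed_segment_def
    by (auto intro!: exI[of _ "?e / ?k"] simp: algebra_simps simp del: inner_diff_left inner_diff_right)
  moreover have "affine hull {P, Q} \<inter> sphere C r = {?T}"
  proof -
    have "X \<in> affine hull {P, Q} \<inter> sphere C r \<longleftrightarrow>
        (\<exists>t. X = P + t *\<^sub>R ?d \<and> norm (P + t *\<^sub>R ?d - C) = r)" for X
      unfolding Int_iff affine_hull_pair_line mem_sphere dist_norm norm_minus_commute[of C X]
      by blast
    then show ?thesis unfolding iff by blast
  qed
  ultimately show ?thesis unfolding side_tangent_def by blast
qed

section \<open>Blaschke products of degree three\<close>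

text \<open>One root comes from the fundamental theorem of algebra; the other two solve the
  quadratic left after dividing it out.\<close>

lemma cubic_vieta:
  fixes e1 e2 e3 :: complex
  obtains x y z where "x + y + z = e1" "x * y + y * z + z * x = e2" "x * y * z = e3"
proof -
  have "\<not> constant (poly [:- e3, e2, - e1, 1:])"
    by (simp add: constant_degree)
  then obtain x where x: "poly [:- e3, e2, - e1, 1:] x = 0"
    using fundamental_theorem_of_algebra by blast
  define D where "D = csqrt ((e1 - x)\<^sup>2 - 4 * (e2 - x * (e1 - x)))"
  define y where "y = (e1 - x + D) / 2"
  define z where "z = (e1 - x - D) / 2"
  have D: "D\<^sup>2 = (e1 - x)\<^sup>2 - 4 * (e2 - x * (e1 - x))" by (simp add: D_def)
  have s: "y + z = e1 - x" by (simp add: y_def z_def field_simps)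
  have "4 * (y * z) = (e1 - x)\<^sup>2 - D\<^sup>2"
    unfolding y_def z_def by (simp add: field_simps power2_eq_square)
  then have "4 * (y * z) = 4 * (e2 - x * (e1 - x))" unfolding D by simp
  then have p: "y * z = e2 - x * (e1 - x)" by (metis mult_cancel_left zero_neq_numeral)
  have "x * (y * z) = e3" unfolding p using x by (simp add: algebra_simps power2_eq_square)
  moreover have "x * y + y * z + z * x = e2"
    using p s by algebra
  moreover have "x + y + z = e1" using s by algebra
  ultimately show ?thesis by (intro that) (simp_all add: mult.assoc)
qed

lemma unit_cnj: "cmod z = 1 \<Longrightarrow> z * cnj z = 1"
  by (metis complex_norm_square of_real_1 one_power2)

text \<open>For \<open>cmod f < 1\<close> this compares the Blaschke factor
  \<open>(z - f) / (1 - cnj f * z)\<close> with modulus 1 according to the side of the unit circle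
  on which \<open>z\<close> lies.\<close>

lemma disc_automorphism_identity:
  "(cmod (1 - cnj f * z))\<^sup>2 - (cmod (z - f))\<^sup>2 = (1 - (cmod f)\<^sup>2) * (1 - (cmod z)\<^sup>2)"
  by (simp add: cmod_power2) algebra

text \<open>Inside the unit disc every Blaschke factor is smaller than 1 in modulus; outside, each
  numerator exceeds its denominator. A unimodular value is therefore possible only on the
  circle.\<close>

lemma blaschke_root_unit:
  assumes f: "cmod f < 1" and g: "cmod g < 1" and l: "cmod l = 1"
    and eq: "z * (z - f) * (z - g) = l * (1 - cnj f * z) * (1 - cnj g * z)"
  shows "cmod z = 1"
proof (rule ccontr)
  assume nz: "cmod z \<noteq> 1"
  have "cmod z * (cmod (z - f) * cmod (z - g)) = cmod (1 - cnj f * z) * cmod (1 - cnj g * z)"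
    using arg_cong[OF eq, of cmod] l by (simp add: norm_mult mult.assoc)
  note e = this
  have pos: "1 - (cmod h)\<^sup>2 > 0" if "cmod h < 1" for h
    using that by (simp add: abs_square_less_1)
  show False
  proof (cases "cmod z < 1")
    case True
    have lt: "cmod (z - h) < cmod (1 - cnj h * z)" if "cmod h < 1" for h
    proof -
      have "(1 - (cmod h)\<^sup>2) * (1 - (cmod z)\<^sup>2) > 0" using pos that True by simp
      then have "(cmod (z - h))\<^sup>2 < (cmod (1 - cnj h * z))\<^sup>2"
        using disc_automorphism_identity[of h z] by linarith
      then show ?thesis using power2_less_imp_less by fastforce
    qed
    have "cmod (z - f) * cmod (z - g) < cmod (1 - cnj f * z) * cmod (1 - cnj g * z)"
      using lt[OF f] lt[OF g] by (intro mult_strict_mono') auto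
    moreover have "cmod z * (cmod (z - f) * cmod (z - g)) \<le> cmod (z - f) * cmod (z - g)"
      using True by (intro mult_left_le_one_le) auto
    ultimately show False using e by linarith
  next
    case False
    then have z1: "cmod z > 1" using nz by simp
    have lt: "cmod (z - h) > cmod (1 - cnj h * z)" if "cmod h < 1" for h
    proof -
      have "(cmod z)\<^sup>2 > 1" using z1 by simp
      then have "(1 - (cmod h)\<^sup>2) * (1 - (cmod z)\<^sup>2) < 0"
        using pos[OF that] by (simp add: mult_pos_neg)
      then have "(cmod (z - h))\<^sup>2 > (cmod (1 - cnj h * z))\<^sup>2"
        using disc_automorphism_identity[of h z] by linarith
      then show ?thesis using power2_less_imp_less by fastforce
    qed
    have "cmod (z - f) * cmod (z - g) > cmod (1 - cnj f * z) * cmod (1 - cnj g * z)"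
      using lt[OF f] lt[OF g] by (intro mult_strict_mono') auto
    moreover have "cmod z * (cmod (z - f) * cmod (z - g)) \<ge> 1 * (cmod (z - f) * cmod (z - g))"
      using z1 by (intro mult_right_mono) auto
    ultimately show False using e by linarith
  qed
qed

text \<open>The map \<open>1 / (1 - u)\<close> takes the unit disc to the half plane right of
  1/2.\<close>

lemma Re_inverse_one_minus:
  assumes "cmod u < 1"
  shows "Re (1 / (1 - u)) > 1 / 2"
proof -
  have ne: "1 - u \<noteq> 0" using assms by auto
  have "(Re u)\<^sup>2 + (Im u)\<^sup>2 < 1" using assms
    unfolding cmod_power2[symmetric] by (simp add: abs_square_less_1)
  then have lt: "(1 - Re u)\<^sup>2 + (Im u)\<^sup>2 < 2 * (1 - Re u)"
    by (simp add: power2_eq_square algebra_simps)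
  have "(cmod (1 - u))\<^sup>2 > 0" using ne by simp
  then have "(1 - Re u)\<^sup>2 + (Im u)\<^sup>2 > 0" by (simp add: cmod_power2)
  then show ?thesis using lt by (simp add: Re_divide field_simps)
qed

text \<open>The expression is the derivative in \<open>z\<close> of the difference of the two sides
  of \<open>eq\<close>. Up to a nonzero factor it is the logarithmic derivative of the Blaschke
  product times \<open>z\<close>, whose real part is positive on the unit circle.\<close>

lemma blaschke_no_critical_point:
  assumes f: "cmod f < 1" and g: "cmod g < 1" and z: "cmod z = 1" and l: "l \<noteq> 0"
    and eq: "z * (z - f) * (z - g) = l * (1 - cnj f * z) * (1 - cnj g * z)"
  shows "(z - f) * (z - g) + z * (z - f) + z * (z - g)
    + l * (cnj f * (1 - cnj g * z) + cnj g * (1 - cnj f * z)) \<noteq> 0"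
proof
  assume d: "(z - f) * (z - g) + z * (z - f) + z * (z - g)
    + l * (cnj f * (1 - cnj g * z) + cnj g * (1 - cnj f * z)) = 0"
  define F where "F = 1 - cnj f * z"
  define G where "G = 1 - cnj g * z"
  have Fr: "Re (1 / F) > 1/2" unfolding F_def
    by (rule Re_inverse_one_minus) (simp add: norm_mult z f)
  have Gr: "Re (1 / G) > 1/2" unfolding G_def
    by (rule Re_inverse_one_minus) (simp add: norm_mult z g)
  have nz: "F \<noteq> 0" "G \<noteq> 0" using Fr Gr by auto
  note u = unit_cnj[OF z]
  have zf: "z - f = z * cnj F" and zg: "z - g = z * cnj G"
    using u unfolding F_def G_def by (simp_all add: algebra_simps)
  have Ff: "cnj f * z = 1 - F" "cnj g * z = 1 - G" by (simp_all add: F_def G_def)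
  have e: "z ^ 3 * (cnj F * cnj G) = l * (F * G)"
    using eq unfolding zf zg F_def[symmetric] G_def[symmetric]
    by (simp add: power3_eq_cube algebra_simps)
  have "z * ((z - f) * (z - g) + z * (z - f) + z * (z - g) + l * (cnj f * G + cnj g * F)) = 0"
    using d unfolding F_def G_def by simp
  then have "z ^ 3 * (cnj F * cnj G + cnj F + cnj G) + l * ((cnj f * z) * G + (cnj g * z) * F) = 0"
    unfolding zf zg by (simp add: power3_eq_cube algebra_simps)
  then have d': "z ^ 3 * (cnj F * cnj G + cnj F + cnj G) + l * ((1 - F) * G + (1 - G) * F) = 0"
    unfolding Ff .
  \<comment> \<open>On the circle \<open>z / (z - f)\<close> is \<open>1 / cnj F\<close>, and
    \<open>cnj f * z / F\<close> is \<open>1 / F - 1\<close>, so the bracket is the logarithmic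
    derivative times \<open>z\<close>. Its real part exceeds 4 * 1/2 - 1 = 1.\<close>
  have "l * (F * G) * (1 / cnj F + 1 / cnj G + 1 / F + 1 / G - 1) =
     (l * (F * G)) * (1 + 1 / cnj F + 1 / cnj G) + l * ((1 - F) * G + (1 - G) * F)"
    using nz by (simp add: field_simps)
  also have "(l * (F * G)) * (1 + 1 / cnj F + 1 / cnj G) = z ^ 3 * (cnj F * cnj G + cnj F + cnj G)"
    unfolding e[symmetric] using nz by (simp add: field_simps)
  finally have "1 / cnj F + 1 / cnj G + 1 / F + 1 / G - 1 = 0"
    using d' nz l by simp
  then have "Re (1 / cnj F + 1 / cnj G + 1 / F + 1 / G - 1) = 0" by simp
  moreover have "Re (1 / cnj F) = Re (1 / F)" "Re (1 / cnj G) = Re (1 / G)"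
    by (simp_all add: Re_divide)
  ultimately show False using Fr Gr by simp
qed

text \<open>The prescribed symmetric functions are those of the roots of \<open>t * (t - f) * (t -
  g) - l * (1 - cnj f * t) * (1 - cnj g * t)\<close>.\<close>

lemma blaschke_fibre:
  assumes f: "cmod f < 1" and g: "cmod g < 1" and l: "cmod l = 1"
  obtains x y z where "cmod x = 1" "cmod y = 1" "cmod z = 1" "x \<noteq> y" "y \<noteq> z" "z \<noteq> x"
    "x + y + z = f + g + cnj (f * g) * l"
    "x * y + y * z + z * x = f * g + cnj (f + g) * l" "x * y * z = l"
proof -
  obtain x y z where v: "x + y + z = f + g + cnj (f * g) * l"
    "x * y + y * z + z * x = f * g + cnj (f + g) * l" "x * y * z = l"
    by (rule cubic_vieta)
  have l0: "l \<noteq> 0" using l by auto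
  have root: "t * (t - f) * (t - g) = l * (1 - cnj f * t) * (1 - cnj g * t)"
    if "(t - x) * (t - y) * (t - z) = 0" for t
  proof -
    have "(t - x) * (t - y) * (t - z) =
        t ^ 3 - (x + y + z) * t\<^sup>2 + (x * y + y * z + z * x) * t - x * y * z"
      by (simp add: power2_eq_square power3_eq_cube algebra_simps)
    also have "\<dots> = t * (t - f) * (t - g) - l * (1 - cnj f * t) * (1 - cnj g * t)"
      unfolding v by (simp add: power2_eq_square power3_eq_cube algebra_simps)
    finally show ?thesis using that by simp
  qed
  have u: "cmod t = 1" if "(t - x) * (t - y) * (t - z) = 0" for t
    using blaschke_root_unit[OF f g l root[OF that]] .
  \<comment> \<open>This is the derivative of the cubic, so the three roots are simple and hence
    distinct.\<close>
  have simple: "(t - x) * (t - y) + (t - y) * (t - z) + (t - z) * (t - x) \<noteq> 0"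
    if "(t - x) * (t - y) * (t - z) = 0" for t
  proof -
    have "(t - x) * (t - y) + (t - y) * (t - z) + (t - z) * (t - x) =
        3 * t\<^sup>2 - 2 * (x + y + z) * t + (x * y + y * z + z * x)"
      by (simp add: power2_eq_square algebra_simps)
    also have "\<dots> = (t - f) * (t - g) + t * (t - f) + t * (t - g)
        + l * (cnj f * (1 - cnj g * t) + cnj g * (1 - cnj f * t))"
      unfolding v by (simp add: power2_eq_square algebra_simps)
    also have "\<dots> \<noteq> 0"
      by (rule blaschke_no_critical_point[OF f g u[OF that] l0 root[OF that]])
    finally show ?thesis .
  qed
  have "x \<noteq> y" "y \<noteq> z" "z \<noteq> x" using simple[of x] simple[of y] simple[of z] by auto
  then show ?thesis using that v u by auto
qed

section \<open>Triangles inscribed in an ellipse\<close>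

definition ellipse_pt :: "real \<Rightarrow> real \<Rightarrow> complex \<Rightarrow> real \<times> real" where
  "ellipse_pt a b z = (a * Re z, b * Im z)"

lemma mem_std_ellipse_iff:
  assumes "a > 0" "b > 0"
  shows "P \<in> std_ellipse a b \<longleftrightarrow> (\<exists>z. cmod z = 1 \<and> P = ellipse_pt a b z)"
proof
  assume P: "P \<in> std_ellipse a b"
  let ?z = "Complex (fst P / a) (snd P / b)"
  have "(cmod ?z)\<^sup>2 = 1"
    using P by (auto simp: std_ellipse_def cmod_power2 power_divide)
  then have "cmod ?z = 1" by (metis norm_ge_zero one_power2 power2_eq_imp_eq zero_le_one)
  moreover have "P = ellipse_pt a b ?z" using assms by (simp add: ellipse_pt_def prod_eq_iff)
  ultimately show "\<exists>z. cmod z = 1 \<and> P = ellipse_pt a b z" by blast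
next
  assume "\<exists>z. cmod z = 1 \<and> P = ellipse_pt a b z"
  then obtain z where z: "cmod z = 1" and P: "P = ellipse_pt a b z" by blast
  have "(Re z)\<^sup>2 + (Im z)\<^sup>2 = 1" using z by (metis cmod_power2 one_power2)
  then show "P \<in> std_ellipse a b"
    using assms unfolding P by (simp add: std_ellipse_def ellipse_pt_def power_mult_distrib)
qed

lemma ellipse_pt_eq_iff:
  assumes "a > 0" "b > 0"
  shows "ellipse_pt a b z = ellipse_pt a b w \<longleftrightarrow> z = w"
  using assms by (simp add: ellipse_pt_def complex_eq_iff)

lemma complex_Re_of_real_mult: "Re (of_real k * z) = k * Re z"
  and complex_Im_of_real_mult: "Im (of_real k * z) = k * Im z"
  by simp_all

lemma two_of_real_Re: "2 * complex_of_real (Re z) = z + cnj z"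
  by (simp add: complex_eq_iff)

lemma two_i_of_real_Im: "2 * \<i> * complex_of_real (Im z) = z - cnj z"
  by (simp add: complex_eq_iff)

text \<open>On the unit circle \<open>cnj z\<close> is \<open>1 / z\<close>, so multiplying by
  \<open>z1 * z2\<close> clears all conjugates of the endpoints. The last factor vanishes exactly
  when \<open>w\<close> lies on the chord line, provided \<open>z1 \<noteq> z2\<close>. The next two
  lemmas use the same device.\<close>

lemma chord_cross:
  assumes "cmod z1 = 1" "cmod z2 = 1"
  shows "2 * \<i> * (z1 * z2) * of_real (Im (cnj (z2 - z1) * (w - z1))) =
    (z1 - z2) * (w + cnj w * (z1 * z2) - (z1 + z2))"
proof -
  let ?u = "cnj (z2 - z1) * (w - z1)"
  have u: "z1 * cnj z1 = 1" "z2 * cnj z2 = 1" using assms unit_cnj by auto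
  have "2 * \<i> * of_real (Im ?u) = ?u - cnj ?u" by (rule two_i_of_real_Im)
  then have "2 * \<i> * (z1 * z2) * of_real (Im ?u) = z1 * z2 * (?u - cnj ?u)"
    by (simp add: mult_ac)
  also have "\<dots> = (z1 - z2) * (w + cnj w * (z1 * z2) - (z1 + z2))"
    using u unfolding complex_cnj_diff complex_cnj_mult complex_cnj_cnj by algebra
  finally show ?thesis .
qed

lemma chord_Re:
  assumes "cmod z1 = 1" "cmod z2 = 1"
  shows "2 * (z1 * z2) * of_real (Re (z2 - z1)) = (z2 - z1) * (z1 * z2 - 1)"
proof -
  have u: "z1 * cnj z1 = 1" "z2 * cnj z2 = 1" using assms unit_cnj by auto
  have "2 * of_real (Re (z2 - z1)) = (z2 - z1) + cnj (z2 - z1)" by (rule two_of_real_Re)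
  then have "2 * (z1 * z2) * of_real (Re (z2 - z1)) = z1 * z2 * ((z2 - z1) + cnj (z2 - z1))"
    by (simp add: mult_ac)
  also have "\<dots> = (z2 - z1) * (z1 * z2 - 1)"
    using u unfolding complex_cnj_diff by algebra
  finally show ?thesis .
qed

lemma chord_Im:
  assumes "cmod z1 = 1" "cmod z2 = 1"
  shows "2 * \<i> * (z1 * z2) * of_real (Im (z2 - z1)) = (z2 - z1) * (z1 * z2 + 1)"
proof -
  have u: "z1 * cnj z1 = 1" "z2 * cnj z2 = 1" using assms unit_cnj by auto
  have "2 * \<i> * of_real (Im (z2 - z1)) = (z2 - z1) - cnj (z2 - z1)"
    by (rule two_i_of_real_Im)
  then have "2 * \<i> * (z1 * z2) * of_real (Im (z2 - z1)) = z1 * z2 * ((z2 - z1) - cnj (z2 - z1))"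
    by (simp add: mult_ac)
  also have "\<dots> = (z2 - z1) * (z1 * z2 + 1)"
    using u unfolding complex_cnj_diff by algebra
  finally show ?thesis .
qed

text \<open>A line meets the circle at most twice: put into the chord equation and multiplied by
  \<open>z3\<close>, the third point gives \<open>(z3 - z1) * (z3 - z2)\<close>.\<close>

lemma ellipse_pt_noncollinear:
  assumes "a > 0" "b > 0" and u: "cmod z1 = 1" "cmod z2 = 1" "cmod z3 = 1"
    and ne: "z1 \<noteq> z2" "z2 \<noteq> z3" "z3 \<noteq> z1"
  shows "\<not> collinear {ellipse_pt a b z1, ellipse_pt a b z2, ellipse_pt a b z3}"
proof
  assume "collinear {ellipse_pt a b z1, ellipse_pt a b z2, ellipse_pt a b z3}"
  then have "a * b * Im (cnj (z2 - z1) * (z3 - z1)) = 0"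
    unfolding collinear_iff_cross ellipse_pt_def by (simp add: algebra_simps)
  then have "Im (cnj (z2 - z1) * (z3 - z1)) = 0" using assms(1,2) by simp
  then have "(z1 - z2) * (z3 + cnj z3 * (z1 * z2) - (z1 + z2)) = 0"
    using chord_cross[OF u(1,2), of z3] by simp
  then have "z3 + cnj z3 * (z1 * z2) - (z1 + z2) = 0" using ne by simp
  moreover have "z3 * (z3 + cnj z3 * (z1 * z2) - (z1 + z2)) = (z3 - z1) * (z3 - z2)"
    using unit_cnj[OF u(3)] by algebra
  ultimately show False using ne by simp
qed

text \<open>Assumption \<open>z\<close> is the cubic with elementary symmetric functions
  \<open>e1\<close>, \<open>e2\<close>, \<open>e3\<close>, divided by its root \<open>z\<close>. The
  right-hand side of the conclusion is free of \<open>z\<close>, so the displayed point is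
  equidistant from all three vertices.\<close>

lemma ellipse_pt_circumcentre_aux:
  assumes a: "a > 0" and b: "b > 0" and u: "cmod z = 1"
    and z: "z * e1 + cnj z * e3 = z\<^sup>2 + e2"
  shows "2 * (((a\<^sup>2 - b\<^sup>2) / (4 * a) * Re (e1 + e3), - ((a\<^sup>2 - b\<^sup>2) / (4 * b) * Im (e1 - e3))) \<bullet> ellipse_pt a b z)
    - ellipse_pt a b z \<bullet> ellipse_pt a b z = (a\<^sup>2 - b\<^sup>2) / 2 * Re e2 - (a\<^sup>2 + b\<^sup>2) / 2"
proof -
  have n: "(Re z)\<^sup>2 + (Im z)\<^sup>2 = 1" using u by (metis cmod_power2 one_power2)
  have "Re (z * e1 + cnj z * e3) = Re (z\<^sup>2 + e2)" using z by simp
  then have r: "Re z * Re (e1 + e3) - Im z * Im (e1 - e3) = (Re z)\<^sup>2 - (Im z)\<^sup>2 + Re e2"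
    by (simp add: power2_eq_square algebra_simps)
  have "2 * (((a\<^sup>2 - b\<^sup>2) / (4 * a) * Re (e1 + e3), - ((a\<^sup>2 - b\<^sup>2) / (4 * b) * Im (e1 - e3))) \<bullet> ellipse_pt a b z)
      = (a\<^sup>2 - b\<^sup>2) / 2 * (Re z * Re (e1 + e3) - Im z * Im (e1 - e3))"
    unfolding ellipse_pt_def inner_prod_def using a b by (simp add: field_simps del: plus_complex.sel minus_complex.sel)
  moreover have "ellipse_pt a b z \<bullet> ellipse_pt a b z = a\<^sup>2 * (Re z)\<^sup>2 + b\<^sup>2 * (Im z)\<^sup>2"
    unfolding ellipse_pt_def inner_prod_def by (simp add: power2_eq_square algebra_simps)
  moreover have "(a\<^sup>2 - b\<^sup>2) / 2 * ((Re z)\<^sup>2 - (Im z)\<^sup>2) - (a\<^sup>2 * (Re z)\<^sup>2 + b\<^sup>2 * (Im z)\<^sup>2) =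
      - ((a\<^sup>2 + b\<^sup>2) / 2) * ((Re z)\<^sup>2 + (Im z)\<^sup>2)"
    by (simp add: field_simps)
  ultimately show ?thesis unfolding r n distrib_left by linarith
qed

lemma euler_center_ellipse_pt:
  assumes a: "a > 0" and b: "b > 0" and u: "cmod z1 = 1" "cmod z2 = 1" "cmod z3 = 1"
    and ne: "z1 \<noteq> z2" "z2 \<noteq> z3" "z3 \<noteq> z1"
    and e1: "e1 = z1 + z2 + z3" and e3: "e3 = z1 * z2 * z3"
  shows "euler_center (ellipse_pt a b z1) (ellipse_pt a b z2) (ellipse_pt a b z3) =
    ((3 * a\<^sup>2 + b\<^sup>2) / (8 * a) * Re e1 - (a\<^sup>2 - b\<^sup>2) / (8 * a) * Re e3,
     (3 * b\<^sup>2 + a\<^sup>2) / (8 * b) * Im e1 - (a\<^sup>2 - b\<^sup>2) / (8 * b) * Im e3)"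
proof -
  let ?O = "((a\<^sup>2 - b\<^sup>2) / (4 * a) * Re (e1 + e3), - ((a\<^sup>2 - b\<^sup>2) / (4 * b) * Im (e1 - e3)))"
  let ?e2 = "z1 * z2 + z2 * z3 + z3 * z1"
  have v: "z1 * cnj z1 = 1" "z2 * cnj z2 = 1" "z3 * cnj z3 = 1" using u unit_cnj by auto
  have "z1 * e1 + cnj z1 * e3 = z1\<^sup>2 + ?e2" "z2 * e1 + cnj z2 * e3 = z2\<^sup>2 + ?e2"
    "z3 * e1 + cnj z3 * e3 = z3\<^sup>2 + ?e2"
    unfolding e1 e3 using v by algebra+
  note eqs = ellipse_pt_circumcentre_aux[OF a b u(1) this(1)]
    ellipse_pt_circumcentre_aux[OF a b u(2) this(2)] ellipse_pt_circumcentre_aux[OF a b u(3) this(3)]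
  from eqs(1) eqs(2) eqs(3) have d: "dist ?O (ellipse_pt a b z1) = dist ?O (ellipse_pt a b z2)"
    "dist ?O (ellipse_pt a b z2) = dist ?O (ellipse_pt a b z3)"
    unfolding dist_eq_iff_inner inner_diff_right right_diff_distrib by (simp_all only:)
  show ?thesis
    unfolding euler_center_eq[OF ellipse_pt_noncollinear[OF a b u ne] d]
    unfolding ellipse_pt_def e1 using a b by (simp add: field_simps power2_eq_square)
qed

section \<open>The Poncelet family\<close>

text \<open>Here \<open>\<xi>\<close>, \<open>\<eta>\<close> are the coordinates of the incenter
  after the ellipse is scaled to the unit circle, and \<open>a * U\<close>, \<open>b * V\<close> are
  the two square roots in the radius formula. \<open>V < U\<close> expresses that the center is
  interior.\<close>

locale poncelet =
  fixes a b c \<xi> \<eta> U V :: real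
  assumes b_pos: "0 < b" and b_less_a: "b < a" and c_sq: "c\<^sup>2 = a\<^sup>2 - b\<^sup>2"
    and U_sq: "U\<^sup>2 = a\<^sup>2 - c\<^sup>2 * \<xi>\<^sup>2" and V_sq: "V\<^sup>2 = b\<^sup>2 + c\<^sup>2 * \<eta>\<^sup>2"
    and V_pos: "0 < V" and V_less_U: "V < U"
begin

text \<open>Scaling turns the incircle into an ellipse with semi-axes \<open>r / a\<close> and, in
  the imaginary direction, \<open>r / b\<close>. Up to sign \<open>h\<close> is its half focal
  distance, and \<open>f\<close>, \<open>g\<close> are its foci.\<close>

definition "h = (U - V) / c"
definition "r = a * b * (U - V) / c\<^sup>2"
definition "\<zeta> = Complex \<xi> \<eta>"
definition "f = \<zeta> + \<i> * of_real h"
definition "g = \<zeta> - \<i> * of_real h"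
definition "C = (a * \<xi>, b * \<eta>)"

abbreviation "pt \<equiv> ellipse_pt a b"

lemma a_pos: "0 < a" and c_sq_pos: "0 < c\<^sup>2" and c_nz: "c \<noteq> 0" and U_pos: "0 < U"
proof -
  show "0 < a" "0 < U" using b_pos b_less_a V_pos V_less_U by auto
  show "0 < c\<^sup>2" unfolding c_sq using b_pos b_less_a by (simp add: power_strict_mono)
  then show "c \<noteq> 0" by auto
qed

lemma U_le_a: "U \<le> a"
proof (rule power2_le_imp_le)
  have "0 \<le> c\<^sup>2 * \<xi>\<^sup>2" by simp
  then show "U\<^sup>2 \<le> a\<^sup>2" using U_sq by linarith
qed (use a_pos in simp)

lemma b_le_V: "b \<le> V"
proof (rule power2_le_imp_le)
  have "0 \<le> c\<^sup>2 * \<eta>\<^sup>2" by simp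
  then show "b\<^sup>2 \<le> V\<^sup>2" using V_sq by linarith
qed (use V_pos in simp)

text \<open>Equality holds only for the center at the origin; there \<open>m\<close> below vanishes
  and the locus is a circle.\<close>

lemma bU_le_aV: "b * U \<le> a * V"
proof -
  have "b * U \<le> b * a" using U_le_a b_pos by simp
  also have "\<dots> \<le> V * a" using b_le_V a_pos by simp
  finally show ?thesis by (simp add: mult.commute)
qed

lemma c_sq_h_sq: "c\<^sup>2 * h\<^sup>2 = (U - V)\<^sup>2"
  using c_nz by (simp add: h_def power_divide)

lemma h_pos: "h\<^sup>2 > 0"
  using c_nz V_less_U by (simp add: h_def)

lemma r_pos: "r > 0"
  using a_pos b_pos c_sq_pos V_less_U by (simp add: r_def)

lemma r_sq: "c\<^sup>2 * r\<^sup>2 = a\<^sup>2 * b\<^sup>2 * h\<^sup>2"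
  using c_nz by (simp add: r_def h_def power_divide power_mult_distrib field_simps power2_eq_square)

lemma fg_sum: "f + g = 2 * \<zeta>" and fg_prod: "f * g = \<zeta>\<^sup>2 + of_real (h\<^sup>2)"
  by (simp_all add: f_def g_def power2_eq_square algebra_simps)

lemma Re_fg: "c\<^sup>2 * Re (f * g) = a\<^sup>2 + b\<^sup>2 - 2 * U * V"
  and Im_fg: "Im (f * g) = 2 * \<xi> * \<eta>"
proof -
  have "Re (f * g) = \<xi>\<^sup>2 - \<eta>\<^sup>2 + h\<^sup>2"
    unfolding fg_prod by (simp add: \<zeta>_def power2_eq_square)
  then have "c\<^sup>2 * Re (f * g) = c\<^sup>2 * \<xi>\<^sup>2 - c\<^sup>2 * \<eta>\<^sup>2 + c\<^sup>2 * h\<^sup>2"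
    by (simp only: right_diff_distrib distrib_left)
  then show "c\<^sup>2 * Re (f * g) = a\<^sup>2 + b\<^sup>2 - 2 * U * V"
    unfolding c_sq_h_sq using U_sq V_sq by (simp add: power2_diff)
  show "Im (f * g) = 2 * \<xi> * \<eta>"
    unfolding fg_prod by (simp add: \<zeta>_def power2_eq_square)
qed

lemma xi_eta_sq: "(c\<^sup>2 * (\<xi> * \<eta>))\<^sup>2 = (a\<^sup>2 - U\<^sup>2) * (V\<^sup>2 - b\<^sup>2)"
proof -
  have "(c\<^sup>2 * (\<xi> * \<eta>))\<^sup>2 = (c\<^sup>2 * \<xi>\<^sup>2) * (c\<^sup>2 * \<eta>\<^sup>2)" by algebra
  then show ?thesis using U_sq V_sq by simp
qed

text \<open>Cayley's condition for the existence of Poncelet triangles.\<close>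

lemma cayley: "c\<^sup>2 * (1 - 2 * (cmod \<zeta>)\<^sup>2 + (cmod (f * g))\<^sup>2) = 2 * h\<^sup>2 * (a\<^sup>2 + b\<^sup>2)"
proof -
  have "(c\<^sup>2)\<^sup>2 * (cmod (f * g))\<^sup>2 = (c\<^sup>2 * Re (f * g))\<^sup>2 + 4 * (c\<^sup>2 * (\<xi> * \<eta>))\<^sup>2"
    unfolding cmod_power2 Im_fg by algebra
  also have "\<dots> = (a\<^sup>2 + b\<^sup>2 - 2 * U * V)\<^sup>2 + 4 * ((a\<^sup>2 - U\<^sup>2) * (V\<^sup>2 - b\<^sup>2))"
    unfolding Re_fg xi_eta_sq ..
  finally have 1: "(c\<^sup>2)\<^sup>2 * (cmod (f * g))\<^sup>2 = \<dots>" .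
  have 2: "c\<^sup>2 * (cmod \<zeta>)\<^sup>2 = a\<^sup>2 - U\<^sup>2 + V\<^sup>2 - b\<^sup>2"
    unfolding cmod_power2 \<zeta>_def using U_sq V_sq by (simp add: algebra_simps)
  have "c\<^sup>2 * (c\<^sup>2 * (1 - 2 * (cmod \<zeta>)\<^sup>2 + (cmod (f * g))\<^sup>2)) =
      c\<^sup>2 * c\<^sup>2 - 2 * c\<^sup>2 * (c\<^sup>2 * (cmod \<zeta>)\<^sup>2) + (c\<^sup>2)\<^sup>2 * (cmod (f * g))\<^sup>2"
    by (simp add: algebra_simps power2_eq_square)
  also have "\<dots> = 2 * (U - V)\<^sup>2 * (a\<^sup>2 + b\<^sup>2)"
    unfolding 1 2 unfolding c_sq by algebra
  also have "\<dots> = c\<^sup>2 * (2 * h\<^sup>2 * (a\<^sup>2 + b\<^sup>2))"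
    unfolding c_sq_h_sq[symmetric] by (simp add: algebra_simps)
  finally show ?thesis using c_sq_pos by (metis mult_left_cancel less_irrefl)
qed

text \<open>Cayley's condition makes \<open>(1 - (cmod f)\<^sup>2) * (1 - (cmod g)\<^sup>2)\<close>
  positive. The factors cannot both be negative, because the squared moduli add up to less than
  2.\<close>

lemma foci_in_disc: "cmod f < 1" "cmod g < 1"
proof -
  have f2: "(cmod f)\<^sup>2 = \<xi>\<^sup>2 + (\<eta> + h)\<^sup>2" and g2: "(cmod g)\<^sup>2 = \<xi>\<^sup>2 + (\<eta> - h)\<^sup>2"
    by (simp_all add: cmod_power2 f_def g_def \<zeta>_def)
  have sum: "(cmod f)\<^sup>2 + (cmod g)\<^sup>2 = 2 * ((cmod \<zeta>)\<^sup>2 + h\<^sup>2)"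
    unfolding f2 g2 unfolding cmod_power2 \<zeta>_def by (simp add: power2_eq_square algebra_simps)
  have "c\<^sup>2 * ((cmod \<zeta>)\<^sup>2 + h\<^sup>2) = a\<^sup>2 - U\<^sup>2 + V\<^sup>2 - b\<^sup>2 + (U - V)\<^sup>2"
    unfolding distrib_left c_sq_h_sq unfolding cmod_power2 \<zeta>_def
    using U_sq V_sq by (simp add: algebra_simps)
  also have "\<dots> = c\<^sup>2 * 1 - 2 * V * (U - V)"
    unfolding c_sq by algebra
  also have "\<dots> < c\<^sup>2 * 1" using V_pos V_less_U by simp
  finally have "(cmod \<zeta>)\<^sup>2 + h\<^sup>2 < 1" using c_sq_pos by (simp only: mult_less_cancel_left_pos)
  then have s2: "(cmod f)\<^sup>2 + (cmod g)\<^sup>2 < 2" unfolding sum by simp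
  have "c\<^sup>2 * ((1 - (cmod f)\<^sup>2) * (1 - (cmod g)\<^sup>2)) =
      c\<^sup>2 * (1 - ((cmod f)\<^sup>2 + (cmod g)\<^sup>2) + (cmod (f * g))\<^sup>2)"
    by (simp add: norm_mult power_mult_distrib algebra_simps)
  also have "\<dots> = c\<^sup>2 * (1 - 2 * (cmod \<zeta>)\<^sup>2 + (cmod (f * g))\<^sup>2) - 2 * h\<^sup>2 * c\<^sup>2"
    unfolding sum by (simp add: algebra_simps)
  also have "\<dots> = 4 * b\<^sup>2 * h\<^sup>2"
    unfolding cayley unfolding c_sq by algebra
  also have "\<dots> > 0" using h_pos b_pos by simp
  finally have "(1 - (cmod f)\<^sup>2) * (1 - (cmod g)\<^sup>2) > 0" using c_sq_pos by (simp only: zero_less_mult_pos)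
  then have "(cmod f)\<^sup>2 < 1" "(cmod g)\<^sup>2 < 1" using s2 by (auto simp: zero_less_mult_iff)
  then show "cmod f < 1" "cmod g < 1" by (simp_all add: abs_square_less_1)
qed

text \<open>This is what remains of the conditions \<open>z\<^sub>1 + z\<^sub>2 + z\<^sub>3 = f + g + cnj (f g) l\<close>,
  \<open>z\<^sub>1 z\<^sub>2 + z\<^sub>2 z\<^sub>3 + z\<^sub>3 z\<^sub>1 = f g + cnj (f + g) l\<close>, \<open>z\<^sub>1 z\<^sub>2 z\<^sub>3 = l\<close> after elimination of \<open>z\<^sub>3\<close> and \<open>l\<close>.\<close>

definition tangent_chord :: "complex \<Rightarrow> complex \<Rightarrow> bool" where
  "tangent_chord z1 z2 \<longleftrightarrow>
    (2 * \<zeta> - (z1 + z2)) * ((z1 + z2) - 2 * cnj \<zeta> * (z1 * z2)) =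
    (f * g - z1 * z2) * (1 - cnj (f * g) * (z1 * z2))"

lemma tangent_chord_iff:
  assumes u: "cmod z1 = 1" "cmod z2 = 1" and ne: "z1 \<noteq> z2"
  shows "((pt z2 - pt z1) \<bullet> (C - pt z1))\<^sup>2 =
      ((pt z2 - pt z1) \<bullet> (pt z2 - pt z1)) * ((C - pt z1) \<bullet> (C - pt z1) - r\<^sup>2)
    \<longleftrightarrow> tangent_chord z1 z2"
proof -
  let ?d = "pt z2 - pt z1" let ?w = "C - pt z1"
  define k where "k = Im (cnj (z2 - z1) * (\<zeta> - z1))"
  define x where "x = Re (z2 - z1)"
  define y where "y = Im (z2 - z1)"
  define \<pi> where "\<pi> = z1 * z2"
  define \<sigma> where "\<sigma> = z1 + z2"
  have nz: "\<pi> \<noteq> 0" using u by (auto simp: \<pi>_def)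
  have dd: "?d \<bullet> ?d = a\<^sup>2 * x\<^sup>2 + b\<^sup>2 * y\<^sup>2"
    unfolding ellipse_pt_def inner_prod_def x_def y_def
    by (simp add: power2_eq_square algebra_simps)
  \<comment> \<open>Lagrange's identity turns the discriminant into a cross product, which the
    scaling multiplies by \<open>a * b\<close>.\<close>
  have "(?d \<bullet> ?d) * (?w \<bullet> ?w) - (?d \<bullet> ?w)\<^sup>2 = (fst ?d * snd ?w - snd ?d * fst ?w)\<^sup>2"
    unfolding inner_prod_def inner_real_def by algebra
  also have "fst ?d * snd ?w - snd ?d * fst ?w = a * b * k"
    unfolding k_def C_def ellipse_pt_def \<zeta>_def by (simp add: algebra_simps)
  finally have lagrange: "(?d \<bullet> ?d) * (?w \<bullet> ?w) - (?d \<bullet> ?w)\<^sup>2 = (a * b * k)\<^sup>2" .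
  have "(?d \<bullet> ?w)\<^sup>2 = (?d \<bullet> ?d) * (?w \<bullet> ?w - r\<^sup>2) \<longleftrightarrow> (a * b * k)\<^sup>2 = r\<^sup>2 * (?d \<bullet> ?d)"
    unfolding lagrange[symmetric] right_diff_distrib by (auto simp: mult.commute)
  also have "\<dots> \<longleftrightarrow> c\<^sup>2 * (a * b * k)\<^sup>2 = c\<^sup>2 * (r\<^sup>2 * (?d \<bullet> ?d))"
    using c_nz by simp
  also have "\<dots> \<longleftrightarrow> (a\<^sup>2 * b\<^sup>2) * (c\<^sup>2 * k\<^sup>2) = (a\<^sup>2 * b\<^sup>2) * (h\<^sup>2 * (a\<^sup>2 * x\<^sup>2 + b\<^sup>2 * y\<^sup>2))"
    unfolding dd mult.assoc[symmetric] r_sq by (simp add: power_mult_distrib mult_ac)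
  also have "\<dots> \<longleftrightarrow> c\<^sup>2 * k\<^sup>2 = h\<^sup>2 * (a\<^sup>2 * x\<^sup>2 + b\<^sup>2 * y\<^sup>2)"
    using a_pos b_pos by simp
  also have "\<dots> \<longleftrightarrow> complex_of_real (c\<^sup>2 * k\<^sup>2) = of_real (h\<^sup>2 * (a\<^sup>2 * x\<^sup>2 + b\<^sup>2 * y\<^sup>2))"
    by (simp only: of_real_eq_iff)
  \<comment> \<open>The factor \<open>4 * \<pi>\<^sup>2\<close> makes both sides polynomial in
    \<open>z1\<close> and \<open>z2\<close>, by the chord identities.\<close>
  also have "\<dots> \<longleftrightarrow> 4 * \<pi>\<^sup>2 * complex_of_real (c\<^sup>2 * k\<^sup>2) = 4 * \<pi>\<^sup>2 * of_real (h\<^sup>2 * (a\<^sup>2 * x\<^sup>2 + b\<^sup>2 * y\<^sup>2))"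
    using nz by simp
  also have "4 * \<pi>\<^sup>2 * complex_of_real (c\<^sup>2 * k\<^sup>2) = - (of_real (c\<^sup>2) * (2 * \<i> * \<pi> * of_real k)\<^sup>2)"
    by (simp add: power_mult_distrib)
  also have "4 * \<pi>\<^sup>2 * of_real (h\<^sup>2 * (a\<^sup>2 * x\<^sup>2 + b\<^sup>2 * y\<^sup>2)) =
      of_real (h\<^sup>2) * (of_real (a\<^sup>2) * (2 * \<pi> * of_real x)\<^sup>2 - of_real (b\<^sup>2) * (2 * \<i> * \<pi> * of_real y)\<^sup>2)"
    by (simp add: power_mult_distrib algebra_simps)
  also have "2 * \<i> * \<pi> * of_real k = (z1 - z2) * (\<zeta> + cnj \<zeta> * \<pi> - \<sigma>)"
    unfolding \<pi>_def \<sigma>_def k_def by (rule chord_cross[OF u])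
  also have "2 * \<pi> * of_real x = (z2 - z1) * (\<pi> - 1)"
    unfolding \<pi>_def x_def by (rule chord_Re[OF u])
  also have "2 * \<i> * \<pi> * of_real y = (z2 - z1) * (\<pi> + 1)"
    unfolding \<pi>_def y_def by (rule chord_Im[OF u])
  also have "- (of_real (c\<^sup>2) * ((z1 - z2) * (\<zeta> + cnj \<zeta> * \<pi> - \<sigma>))\<^sup>2) =
      of_real (h\<^sup>2) * (of_real (a\<^sup>2) * ((z2 - z1) * (\<pi> - 1))\<^sup>2 - of_real (b\<^sup>2) * ((z2 - z1) * (\<pi> + 1))\<^sup>2)
    \<longleftrightarrow> (z1 - z2)\<^sup>2 * (of_real (c\<^sup>2) * (\<zeta> + cnj \<zeta> * \<pi> - \<sigma>)\<^sup>2
        + of_real (h\<^sup>2) * (of_real (a\<^sup>2) * (\<pi> - 1)\<^sup>2 - of_real (b\<^sup>2) * (\<pi> + 1)\<^sup>2)) = 0"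
    by algebra
  also have "\<dots> \<longleftrightarrow> of_real (c\<^sup>2) * (\<zeta> + cnj \<zeta> * \<pi> - \<sigma>)\<^sup>2
        + of_real (h\<^sup>2) * (of_real (a\<^sup>2) * (\<pi> - 1)\<^sup>2 - of_real (b\<^sup>2) * (\<pi> + 1)\<^sup>2) = 0"
    using ne by simp
  also have "of_real (h\<^sup>2) * (of_real (a\<^sup>2) * (\<pi> - 1)\<^sup>2 - of_real (b\<^sup>2) * (\<pi> + 1)\<^sup>2) =
      of_real (a\<^sup>2 - b\<^sup>2) * of_real (h\<^sup>2) * (1 + \<pi>\<^sup>2) - of_real (2 * h\<^sup>2 * (a\<^sup>2 + b\<^sup>2)) * \<pi>"
    by (simp add: power2_eq_square algebra_simps)
  \<comment> \<open>Cayley's condition trades \<open>a\<close> and \<open>b\<close> for the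
    foci.\<close>
  also have "\<dots> = of_real (c\<^sup>2) * (of_real (h\<^sup>2) * (1 + \<pi>\<^sup>2)
      - (1 - 2 * (\<zeta> * cnj \<zeta>) + (f * g) * cnj (f * g)) * \<pi>)"
    unfolding cayley[symmetric] c_sq[symmetric] complex_norm_square[symmetric]
    by (simp add: algebra_simps)
  also have "of_real (c\<^sup>2) * (\<zeta> + cnj \<zeta> * \<pi> - \<sigma>)\<^sup>2 + \<dots> = of_real (c\<^sup>2) *
      ((f * g - \<pi>) * (1 - cnj (f * g) * \<pi>) - (2 * \<zeta> - \<sigma>) * (\<sigma> - 2 * cnj \<zeta> * \<pi>))"
  proof -
    have "cnj (f * g) = (cnj \<zeta>)\<^sup>2 + of_real (h\<^sup>2)" unfolding fg_prod by simp
    then show ?thesis unfolding fg_prod by algebra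
  qed
  also have "\<dots> = 0 \<longleftrightarrow> tangent_chord z1 z2"
    using c_nz unfolding tangent_chord_def \<pi>_def \<sigma>_def by auto
  finally show ?thesis .
qed

text \<open>For fixed \<open>z2\<close> tangency is a quadratic equation in the other endpoint, with
  leading coefficient \<open>L\<close>. Its distinct roots are \<open>z1\<close> and
  \<open>z3\<close>, and Vieta gives their sum and product.\<close>

lemma tangent_triangle_vertex_sum:
  assumes u: "cmod z2 = 1" and ne: "z1 \<noteq> z3"
    and t: "tangent_chord z1 z2" "tangent_chord z2 z3"
  shows "z1 + z2 + z3 = 2 * \<zeta> + cnj (f * g) * (z1 * z2 * z3)"
proof -
  define L where "L = (1 - cnj f * z2) * (1 - cnj g * z2)"
  have "cmod (cnj f * z2) < 1" "cmod (cnj g * z2) < 1"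
    using foci_in_disc u by (simp_all add: norm_mult)
  then have nz: "L \<noteq> 0" unfolding L_def by auto
  have "cnj f + cnj g = 2 * cnj \<zeta>" using arg_cong[OF fg_sum, of cnj] by simp
  then have L: "L = 1 - 2 * cnj \<zeta> * z2 + cnj (f * g) * z2\<^sup>2"
    unfolding L_def complex_cnj_mult by algebra
  define p where "p = f * g"
  define q where "q = cnj (f * g)"
  define s where "s = cnj \<zeta>"
  have t1: "(2 * \<zeta> - (z1 + z2)) * ((z1 + z2) - 2 * s * (z1 * z2)) = (p - z1 * z2) * (1 - q * (z1 * z2))"
    and t3: "(2 * \<zeta> - (z2 + z3)) * ((z2 + z3) - 2 * s * (z2 * z3)) = (p - z2 * z3) * (1 - q * (z2 * z3))"
    using t unfolding tangent_chord_def p_def q_def s_def by simp_all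
  have L': "L = 1 - 2 * s * z2 + q * z2\<^sup>2" using L unfolding s_def q_def .
  define M where "M = - 2 * \<zeta> + (1 + 4 * \<zeta> * s - p * q) * z2 - 2 * s * z2\<^sup>2"
  define N where "N = z2\<^sup>2 - 2 * \<zeta> * z2 + p"
  have e1: "L * z1\<^sup>2 + M * z1 + N = 0"
    using t1 unfolding L' M_def N_def by algebra
  have e3: "L * z3\<^sup>2 + M * z3 + N = 0"
    using t3 unfolding L' M_def N_def by algebra
  have "(z1 - z3) * (L * (z1 + z3) + M) = 0" using e1 e3 by algebra
  then have v1: "L * (z1 + z3) + M = 0" using ne by simp
  then have v2: "L * (z1 * z3) = N" using e1 by algebra
  have "L * (z1 + z2 + z3 - (2 * \<zeta> + q * (z1 * z2 * z3))) =
     - M + L * (z2 - 2 * \<zeta>) - q * z2 * N"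
    using v1 v2 by algebra
  also have "\<dots> = 0" unfolding L' M_def N_def by algebra
  finally show ?thesis using nz unfolding q_def by simp
qed

lemma tangent_triangle_exists:
  assumes "cmod l = 1"
  obtains z1 z2 z3 where "cmod z1 = 1" "cmod z2 = 1" "cmod z3 = 1" "z1 \<noteq> z2" "z2 \<noteq> z3" "z3 \<noteq> z1"
    "tangent_chord z1 z2" "tangent_chord z2 z3" "tangent_chord z3 z1" "z1 * z2 * z3 = l"
proof -
  obtain z1 z2 z3 where u: "cmod z1 = 1" "cmod z2 = 1" "cmod z3 = 1"
    and ne: "z1 \<noteq> z2" "z2 \<noteq> z3" "z3 \<noteq> z1"
    and "z1 + z2 + z3 = f + g + cnj (f * g) * l"
    "z1 * z2 + z2 * z3 + z3 * z1 = f * g + cnj (f + g) * l" and e3: "z1 * z2 * z3 = l"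
    using blaschke_fibre[OF foci_in_disc assms] by metis
  then have e1: "z1 + z2 + z3 = 2 * \<zeta> + cnj (f * g) * (z1 * z2 * z3)"
    and e2: "z1 * z2 + z2 * z3 + z3 * z1 = f * g + 2 * cnj \<zeta> * (z1 * z2 * z3)"
    unfolding fg_sum by simp_all
  have tc: "tangent_chord x y"
    if "x + y + z = 2 * \<zeta> + cnj (f * g) * (x * y * z)"
      "x * y + y * z + z * x = f * g + 2 * cnj \<zeta> * (x * y * z)" for x y z
  proof -
    \<comment> \<open>With these two identities both sides of the tangency condition acquire the
      same three factors.\<close>
    have "2 * \<zeta> - (x + y) = z * (1 - cnj (f * g) * (x * y))"
      "f * g - x * y = z * ((x + y) - 2 * cnj \<zeta> * (x * y))"
      using that by algebra+
    then show ?thesis unfolding tangent_chord_def by (simp only: mult_ac)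
  qed
  have "tangent_chord z1 z2" using tc[of z1 z2 z3] e1 e2 by blast
  moreover have "tangent_chord z2 z3" using tc[of z2 z3 z1] e1 e2 by (simp only: mult_ac add_ac)
  moreover have "tangent_chord z3 z1" using tc[of z3 z1 z2] e1 e2 by (simp only: mult_ac add_ac)
  ultimately show ?thesis using that u ne e3 by blast
qed

section \<open>The circle lies inside the ellipse, so contact points lie on the sides\<close>

lemma incircle_nested:
  assumes "norm (pt t - C) = r"
  shows "cmod t \<le> 1"
proof (rule ccontr)
  assume out: "\<not> ?thesis"
  \<comment> \<open>\<open>S\<close> is \<open>m\<close> times a member of the pencil spanned by the circle and the ellipse; the multiplier
    \<open>a\<^sup>2 b\<^sup>2 d / m\<close> of the ellipse is chosen such that this member is nonnegative on the whole plane.\<close>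
  define d where "d = U - V"
  define m where "m = c\<^sup>2 * U"
  define A where "A = m - b\<^sup>2 * d"
  define B where "B = m - a\<^sup>2 * d"
  define x where "x = Re t"
  define y where "y = Im t"
  define S where "S = m * ((a * x - a * \<xi>)\<^sup>2 + (b * y - b * \<eta>)\<^sup>2 - r\<^sup>2) + a\<^sup>2 * b\<^sup>2 * d * (1 - x\<^sup>2 - y\<^sup>2)"
  define R where "R = a\<^sup>2 * b\<^sup>2 * d * (A * B) - m * (a\<^sup>2 * b\<^sup>2 * d) * (\<xi>\<^sup>2 * B + \<eta>\<^sup>2 * A) - m * r\<^sup>2 * (A * B)"
  have d: "d > 0" using V_less_U by (simp add: d_def)
  have "(norm (pt t - C))\<^sup>2 = r\<^sup>2" using assms by simp
  then have circ: "(a * x - a * \<xi>)\<^sup>2 + (b * y - b * \<eta>)\<^sup>2 - r\<^sup>2 = 0"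
    unfolding power2_norm_eq_inner C_def ellipse_pt_def inner_prod_def x_def y_def
    by (simp add: power2_eq_square)
  have "1 < (cmod t)\<^sup>2" using out by simp
  then have "1 - x\<^sup>2 - y\<^sup>2 < 0" unfolding cmod_power2 x_def y_def by linarith
  then have S_neg: "S < 0"
    unfolding S_def circ using d a_pos b_pos by (simp add: mult_pos_neg)
  have "b * (b * U) < a * (a * V)"
  proof -
    have "b * (b * U) \<le> b * (a * V)" using bU_le_aV b_pos by simp
    also have "\<dots> < a * (a * V)" using b_less_a a_pos V_pos by simp
    finally show ?thesis .
  qed
  moreover have "B = a * (a * V) - b * (b * U)"
    unfolding B_def m_def d_def c_sq by algebra
  ultimately have B_pos: "B > 0" by simp
  have "b\<^sup>2 * d \<le> a\<^sup>2 * d"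
    using d b_less_a b_pos by (intro mult_right_mono power_mono) auto
  then have A_pos: "A > 0" using B_pos unfolding A_def B_def by linarith
  have "d * U \<le> c\<^sup>2"
  proof -
    have "d * U \<le> (a - b) * a"
      using d U_pos U_le_a b_le_V b_less_a unfolding d_def by (intro mult_mono) auto
    also have "\<dots> \<le> (a - b) * (a + b)" using b_less_a b_pos by (intro mult_left_mono) auto
    also have "\<dots> = c\<^sup>2" unfolding c_sq by algebra
    finally show ?thesis .
  qed
  then have "b\<^sup>2 * (d * U) \<le> a\<^sup>2 * c\<^sup>2"
    using b_less_a b_pos d U_pos by (intro mult_mono power_mono) auto
  \<comment> \<open>Completing the squares in \<open>x\<close> and \<open>y\<close> leaves the
    constant \<open>R\<close>, whose sign decides.\<close>
  have 1: "A * B * S = a\<^sup>2 * B * (A * x - m * \<xi>)\<^sup>2 + b\<^sup>2 * A * (B * y - m * \<eta>)\<^sup>2 + R"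
    unfolding S_def R_def A_def B_def by algebra
  have "c\<^sup>2 * (m * r\<^sup>2) = U * (a\<^sup>2 * b\<^sup>2 * d\<^sup>2)"
    using r_sq c_sq_h_sq unfolding m_def d_def by algebra
  then have "c\<^sup>2 * R = a\<^sup>2 * b\<^sup>2 * d * ((c\<^sup>2 - d * U) * (A * B) - m * ((c\<^sup>2 * \<xi>\<^sup>2) * B + (c\<^sup>2 * \<eta>\<^sup>2) * A))"
    unfolding R_def by algebra
  also have "\<dots> = a\<^sup>2 * b\<^sup>2 * d * ((c\<^sup>2 - d * U) * (A * B) - m * ((a\<^sup>2 - U\<^sup>2) * B + (V\<^sup>2 - b\<^sup>2) * A))"
    using U_sq V_sq by simp
  also have "(c\<^sup>2 - d * U) * (A * B) - m * ((a\<^sup>2 - U\<^sup>2) * B + (V\<^sup>2 - b\<^sup>2) * A) =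
      b\<^sup>2 * d\<^sup>2 * (a\<^sup>2 * c\<^sup>2 - b\<^sup>2 * (d * U))"
    unfolding A_def B_def m_def c_sq d_def by algebra
  finally have "c\<^sup>2 * R = a\<^sup>2 * b\<^sup>2 * d * (b\<^sup>2 * d\<^sup>2 * (a\<^sup>2 * c\<^sup>2 - b\<^sup>2 * (d * U)))" .
  also have "\<dots> \<ge> 0"
    using \<open>b\<^sup>2 * (d * U) \<le> a\<^sup>2 * c\<^sup>2\<close> d by simp
  finally have "R \<ge> 0" using c_sq_pos by (simp add: zero_le_mult_iff)
  then have "A * B * S \<ge> 0" unfolding 1 using A_pos B_pos by simp
  moreover have "A * B > 0" using A_pos B_pos by simp
  ultimately show False using S_neg by (metis mult_pos_neg not_less)
qed

text \<open>A contact point lies in the closed unit disc after scaling. The point with parameter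
  \<open>t\<close> on the chord line has squared modulus
  \<open>1 + t * (t - 1) * (cmod (z2 - z1))\<^sup>2\<close>, which forces \<open>t\<close> between 0
  and 1.\<close>

lemma side_tangent_iff:
  assumes u: "cmod z1 = 1" "cmod z2 = 1" and ne: "z1 \<noteq> z2"
  shows "side_tangent (pt z1) (pt z2) C r \<longleftrightarrow> tangent_chord z1 z2"
proof
  have ne': "pt z1 \<noteq> pt z2" using ne a_pos b_pos by (simp add: ellipse_pt_eq_iff)
  show "tangent_chord z1 z2" if "side_tangent (pt z1) (pt z2) C r"
    using side_tangent_imp[OF ne' that] unfolding tangent_chord_iff[OF u ne] .
  assume "tangent_chord z1 z2"
  note eq = this[folded tangent_chord_iff[OF u ne]]
  have n: "(Re z1)\<^sup>2 + (Im z1)\<^sup>2 = 1" "(Re z2)\<^sup>2 + (Im z2)\<^sup>2 = 1"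
    using u by (metis cmod_power2 one_power2)+
  show "side_tangent (pt z1) (pt z2) C r"
  proof (rule side_tangentI[OF ne' _ eq])
    show "r \<ge> 0" using r_pos by simp
    fix t assume t: "norm (pt z1 + t *\<^sub>R (pt z2 - pt z1) - C) = r"
    have "pt z1 + t *\<^sub>R (pt z2 - pt z1) = pt (z1 + of_real t * (z2 - z1))"
      by (simp add: ellipse_pt_def algebra_simps)
    then have "cmod (z1 + of_real t * (z2 - z1)) \<le> 1" using t incircle_nested by simp
    then have "(cmod (z1 + of_real t * (z2 - z1)))\<^sup>2 \<le> 1" by (simp add: power_le_one)
    moreover have "(cmod (z1 + of_real t * (z2 - z1)))\<^sup>2 = 1 + t * (t - 1) * (cmod (z2 - z1))\<^sup>2"
      unfolding cmod_power2 using n by simp algebra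
    ultimately have "t * (t - 1) * (cmod (z2 - z1))\<^sup>2 \<le> 0" by simp
    then have "t * (t - 1) \<le> 0" using ne by (simp add: mult_le_0_iff)
    then show "0 \<le> t \<and> t \<le> 1" by (auto simp: mult_le_0_iff)
  qed
qed

lemma poncelet_triangles_iff:
  "(P, Q, R) \<in> poncelet_triangles a b C r \<longleftrightarrow>
    (\<exists>z1 z2 z3. P = pt z1 \<and> Q = pt z2 \<and> R = pt z3 \<and> cmod z1 = 1 \<and> cmod z2 = 1 \<and> cmod z3 = 1 \<and>
      z1 \<noteq> z2 \<and> z2 \<noteq> z3 \<and> z3 \<noteq> z1 \<and>
      tangent_chord z1 z2 \<and> tangent_chord z2 z3 \<and> tangent_chord z3 z1)"
  (is "?l \<longleftrightarrow> ?r")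
proof
  assume l: ?l
  then have nc: "\<not> collinear {P, Q, R}" and "P \<in> std_ellipse a b" "Q \<in> std_ellipse a b" "R \<in> std_ellipse a b"
    and t: "side_tangent P Q C r" "side_tangent Q R C r" "side_tangent R P C r"
    unfolding poncelet_triangles_def by auto
  then obtain z1 z2 z3 where z: "P = pt z1" "Q = pt z2" "R = pt z3"
    "cmod z1 = 1" "cmod z2 = 1" "cmod z3 = 1"
    unfolding mem_std_ellipse_iff[OF a_pos b_pos] by blast
  have "P \<noteq> Q" "Q \<noteq> R" "R \<noteq> P" using nc by (auto simp: insert_commute)
  then have ne: "z1 \<noteq> z2" "z2 \<noteq> z3" "z3 \<noteq> z1" using z by auto
  then show ?r using z t side_tangent_iff by blast
next
  assume ?r
  then obtain z1 z2 z3 where z: "P = pt z1" "Q = pt z2" "R = pt z3"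
    "cmod z1 = 1" "cmod z2 = 1" "cmod z3 = 1" "z1 \<noteq> z2" "z2 \<noteq> z3" "z3 \<noteq> z1"
    "tangent_chord z1 z2" "tangent_chord z2 z3" "tangent_chord z3 z1" by blast
  then have "\<not> collinear {P, Q, R}" using ellipse_pt_noncollinear[OF a_pos b_pos] by simp
  moreover have "{P, Q, R} \<subseteq> std_ellipse a b"
    using z by (auto simp: mem_std_ellipse_iff[OF a_pos b_pos])
  ultimately show ?l unfolding poncelet_triangles_def using z side_tangent_iff by simp
qed

section \<open>The locus of the Euler center and its focal data\<close>

definition "ctr = ((3 * a\<^sup>2 + b\<^sup>2) / (4 * a) * \<xi>, (3 * b\<^sup>2 + a\<^sup>2) / (4 * b) * \<eta>)"
text \<open>\<open>m\<close> and \<open>n\<close> are the coefficients of \<open>l\<close> and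
  \<open>cnj l\<close> when \<open>2 * \<zeta> + cnj (f * g) * l\<close> is inserted for the vertex
  sum in the Euler center formula; \<open>ctr\<close> is the part free of \<open>l\<close>. The
  vector from \<open>ctr\<close> to \<open>C\<close> is \<open>w\<close>.\<close>

definition "m = of_real ((a + b)\<^sup>2 / (16 * a * b)) * (of_real (a + b) * cnj (f * g) - of_real (a - b))"
definition "n = of_real ((a - b)\<^sup>2 / (16 * a * b)) * (of_real (a + b) - of_real (a - b) * (f * g))"
definition "w = Complex (c\<^sup>2 * \<xi> / (4 * a)) (- (c\<^sup>2 * \<eta> / (4 * b)))"

lemma euler_center_tangent_triangle:
  assumes u: "cmod z1 = 1" "cmod z2 = 1" "cmod z3 = 1" and ne: "z1 \<noteq> z2" "z2 \<noteq> z3" "z3 \<noteq> z1"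
    and t: "tangent_chord z1 z2" "tangent_chord z2 z3" and l: "l = z1 * z2 * z3"
  shows "euler_center (pt z1) (pt z2) (pt z3) =
    ctr + (Re (m * l + n * cnj l), Im (m * l + n * cnj l))"
proof -
  have e1: "z1 + z2 + z3 = 2 * \<zeta> + cnj (f * g) * l"
    using tangent_triangle_vertex_sum[of z2 z1 z3] assms by auto
  define F where "F = f * g"
  define p where "p = Re F"
  define q where "q = Im F"
  define x where "x = Re l"
  define y where "y = Im l"
  have E1: "Re (2 * \<zeta> + cnj F * l) = 2 * \<xi> + p * x + q * y"
    "Im (2 * \<zeta> + cnj F * l) = 2 * \<eta> + p * y - q * x"
    unfolding p_def q_def x_def y_def by (simp_all add: \<zeta>_def)
  have m: "Re m = (a + b)\<^sup>2 / (16 * a * b) * ((a + b) * p - (a - b))"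
    "Im m = - ((a + b)\<^sup>2 / (16 * a * b) * ((a + b) * q))"
    and n: "Re n = (a - b)\<^sup>2 / (16 * a * b) * ((a + b) - (a - b) * p)"
    "Im n = - ((a - b)\<^sup>2 / (16 * a * b) * ((a - b) * q))"
    unfolding m_def n_def F_def[symmetric] p_def q_def
      complex_Re_of_real_mult complex_Im_of_real_mult by simp_all
  have M: "Re (m * l + n * cnj l) = (Re m + Re n) * x + (Im n - Im m) * y"
    "Im (m * l + n * cnj l) = (Im m + Im n) * x + (Re m - Re n) * y"
    unfolding x_def y_def by (simp_all add: algebra_simps)
  show ?thesis
    unfolding euler_center_ellipse_pt[OF a_pos b_pos u ne refl refl] unfolding e1 l[symmetric] F_def[symmetric] E1 M m n
      x_def[symmetric] y_def[symmetric] ctr_def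
    using a_pos b_pos by (simp add: field_simps; algebra)
qed

text \<open>The product of the vertices of a member is unimodular, and conversely every unimodular
  \<open>l\<close> is such a product, so no arc of the ellipse is missed.\<close>

lemma euler_locus_eq:
  "euler_locus a b C r = {ctr + (Re v, Im v) | v. \<exists>l. cmod l = 1 \<and> v = m * l + n * cnj l}"
proof (intro set_eqI iffI)
  fix X assume "X \<in> euler_locus a b C r"
  then obtain P Q R where X: "X = euler_center P Q R" and T: "(P, Q, R) \<in> poncelet_triangles a b C r"
    unfolding euler_locus_def by blast
  obtain z1 z2 z3 where z: "P = pt z1" "Q = pt z2" "R = pt z3"
    and u: "cmod z1 = 1" "cmod z2 = 1" "cmod z3 = 1" and ne: "z1 \<noteq> z2" "z2 \<noteq> z3" "z3 \<noteq> z1"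
    and t: "tangent_chord z1 z2" "tangent_chord z2 z3"
    using T unfolding poncelet_triangles_iff by blast
  have "cmod (z1 * z2 * z3) = 1" using u by (simp add: norm_mult)
  then show "X \<in> {ctr + (Re v, Im v) | v. \<exists>l. cmod l = 1 \<and> v = m * l + n * cnj l}"
    unfolding X z euler_center_tangent_triangle[OF u ne t refl] by blast
next
  fix X assume "X \<in> {ctr + (Re v, Im v) | v. \<exists>l. cmod l = 1 \<and> v = m * l + n * cnj l}"
  then obtain l where l: "cmod l = 1" and X: "X = ctr + (Re (m * l + n * cnj l), Im (m * l + n * cnj l))"
    by blast
  obtain z1 z2 z3 where u: "cmod z1 = 1" "cmod z2 = 1" "cmod z3 = 1" and ne: "z1 \<noteq> z2" "z2 \<noteq> z3" "z3 \<noteq> z1"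
    and t: "tangent_chord z1 z2" "tangent_chord z2 z3" "tangent_chord z3 z1" and e3: "z1 * z2 * z3 = l"
    using tangent_triangle_exists[OF l] by metis
  have "X = euler_center (pt z1) (pt z2) (pt z3)"
    unfolding X using euler_center_tangent_triangle[OF u ne t(1,2) e3[symmetric]] by simp
  moreover have "(pt z1, pt z2, pt z3) \<in> poncelet_triangles a b C r"
    unfolding poncelet_triangles_iff using u ne t by blast
  ultimately show "X \<in> euler_locus a b C r" unfolding euler_locus_def by blast
qed

text \<open>\<open>m\<close> and \<open>n\<close> are positive real multiples of the numbers
  \<open>u\<close> and \<open>v\<close> below. The squared moduli of these are perfect squares in
  \<open>a\<close>, \<open>b\<close>, \<open>U\<close>, \<open>V\<close>, and \<open>u * v\<close>
  is \<open>c\<^sup>2\<close> times a square.\<close>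

lemma cmod_m: "cmod m = (a + b) ^ 3 * (a * V - b * U) / (8 * a * b * c\<^sup>2)"
  and cmod_n: "cmod n = (a - b) ^ 3 * (a * V + b * U) / (8 * a * b * c\<^sup>2)"
  and w_sq: "w\<^sup>2 = 4 * m * n"
proof -
  define u where "u = Complex (a * b - U * V) (- (c\<^sup>2 * (\<xi> * \<eta>)))"
  define v where "v = Complex (a * b + U * V) (- (c\<^sup>2 * (\<xi> * \<eta>)))"
  have "(cmod u)\<^sup>2 = (a * V - b * U)\<^sup>2"
    unfolding cmod_power2 u_def complex.sel power2_minus xi_eta_sq by algebra
  \<comment> \<open>The sign of the root comes from \<open>bU_le_aV\<close>.\<close>
  then have nu: "cmod u = a * V - b * U"
    using bU_le_aV by simp
  have "(cmod v)\<^sup>2 = (a * V + b * U)\<^sup>2"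
    unfolding cmod_power2 v_def complex.sel power2_minus xi_eta_sq by algebra
  then have nv: "cmod v = a * V + b * U"
    using a_pos b_pos U_pos V_pos by (simp add: power2_eq_iff_nonneg)
  define F where "F = f * g"
  have re: "c\<^sup>2 * Re F = a\<^sup>2 + b\<^sup>2 - 2 * U * V" using Re_fg by (simp add: F_def)
  have im: "Im F = 2 * \<xi> * \<eta>" using Im_fg by (simp add: F_def)
  have "of_real (c\<^sup>2) * (of_real (a + b) * cnj F - of_real (a - b)) = of_real (2 * (a + b)) * u"
  proof (rule complex_eqI)
    have "(a + b) * (c\<^sup>2 * Re F) - c\<^sup>2 * (a - b) = 2 * (a + b) * (a * b - U * V)"
      unfolding re unfolding c_sq by algebra
    then show "Re (of_real (c\<^sup>2) * (of_real (a + b) * cnj F - of_real (a - b))) = Re (of_real (2 * (a + b)) * u)"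
      unfolding complex_Re_of_real_mult minus_complex.sel u_def by (simp add: algebra_simps)
    show "Im (of_real (c\<^sup>2) * (of_real (a + b) * cnj F - of_real (a - b))) = Im (of_real (2 * (a + b)) * u)"
      unfolding complex_Im_of_real_mult minus_complex.sel u_def by (simp add: im)
  qed
  then have "of_real (a + b) * cnj F - of_real (a - b) = of_real (2 * (a + b) / c\<^sup>2) * u"
    using c_nz by (simp add: field_simps)
  then have "m = of_real ((a + b)\<^sup>2 / (16 * a * b) * (2 * (a + b) / c\<^sup>2)) * u"
    unfolding m_def F_def[symmetric] of_real_mult by (simp only: mult.assoc)
  also have "(a + b)\<^sup>2 / (16 * a * b) * (2 * (a + b) / c\<^sup>2) = (a + b) ^ 3 / (8 * a * b * c\<^sup>2)"
    using a_pos b_pos c_nz by (simp add: divide_simps) algebra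
  finally have m: "m = of_real ((a + b) ^ 3 / (8 * a * b * c\<^sup>2)) * u" .
  have "of_real (c\<^sup>2) * (of_real (a + b) - of_real (a - b) * F) = of_real (2 * (a - b)) * v"
  proof (rule complex_eqI)
    have "c\<^sup>2 * (a + b) - (a - b) * (c\<^sup>2 * Re F) = 2 * (a - b) * (a * b + U * V)"
      unfolding re unfolding c_sq by algebra
    then show "Re (of_real (c\<^sup>2) * (of_real (a + b) - of_real (a - b) * F)) = Re (of_real (2 * (a - b)) * v)"
      unfolding complex_Re_of_real_mult minus_complex.sel v_def by (simp add: algebra_simps)
    show "Im (of_real (c\<^sup>2) * (of_real (a + b) - of_real (a - b) * F)) = Im (of_real (2 * (a - b)) * v)"
      unfolding complex_Im_of_real_mult minus_complex.sel v_def by (simp add: im)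
  qed
  then have "of_real (a + b) - of_real (a - b) * F = of_real (2 * (a - b) / c\<^sup>2) * v"
    using c_nz by (simp add: field_simps)
  then have "n = of_real ((a - b)\<^sup>2 / (16 * a * b) * (2 * (a - b) / c\<^sup>2)) * v"
    unfolding n_def F_def[symmetric] of_real_mult by (simp only: mult.assoc)
  also have "(a - b)\<^sup>2 / (16 * a * b) * (2 * (a - b) / c\<^sup>2) = (a - b) ^ 3 / (8 * a * b * c\<^sup>2)"
    using a_pos b_pos c_nz by (simp add: divide_simps) algebra
  finally have n: "n = of_real ((a - b) ^ 3 / (8 * a * b * c\<^sup>2)) * v" .
  have k: "(a + b) ^ 3 / (8 * a * b * c\<^sup>2) \<ge> 0" "(a - b) ^ 3 / (8 * a * b * c\<^sup>2) \<ge> 0"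
    using a_pos b_pos b_less_a c_sq_pos by simp_all
  show "cmod m = (a + b) ^ 3 * (a * V - b * U) / (8 * a * b * c\<^sup>2)"
    unfolding m norm_mult norm_of_real nu abs_of_nonneg[OF k(1)] by simp
  show "cmod n = (a - b) ^ 3 * (a * V + b * U) / (8 * a * b * c\<^sup>2)"
    unfolding n norm_mult norm_of_real nv abs_of_nonneg[OF k(2)] by simp
  let ?z = "Complex (b * \<xi>) (- (a * \<eta>))"
  have uv: "u * v = of_real (c\<^sup>2) * ?z\<^sup>2"
  proof (rule complex_eqI)
    have "(a * b)\<^sup>2 - (U * V)\<^sup>2 - (c\<^sup>2 * (\<xi> * \<eta>))\<^sup>2 = b\<^sup>2 * (a\<^sup>2 - U\<^sup>2) - a\<^sup>2 * (V\<^sup>2 - b\<^sup>2)"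
      unfolding xi_eta_sq by algebra
    also have "\<dots> = c\<^sup>2 * ((b * \<xi>)\<^sup>2 - (a * \<eta>)\<^sup>2)" unfolding U_sq V_sq by algebra
    finally show "Re (u * v) = Re (of_real (c\<^sup>2) * ?z\<^sup>2)"
      unfolding complex_Re_of_real_mult u_def v_def by (simp add: power2_eq_square algebra_simps)
    show "Im (u * v) = Im (of_real (c\<^sup>2) * ?z\<^sup>2)"
      unfolding complex_Im_of_real_mult u_def v_def by (simp add: power2_eq_square algebra_simps)
  qed
  have "4 * m * n = of_real (4 * ((a + b) ^ 3 / (8 * a * b * c\<^sup>2)) * ((a - b) ^ 3 / (8 * a * b * c\<^sup>2)) * c\<^sup>2) * ?z\<^sup>2"
    unfolding m n using uv by (simp add: mult_ac)
  also have "4 * ((a + b) ^ 3 / (8 * a * b * c\<^sup>2)) * ((a - b) ^ 3 / (8 * a * b * c\<^sup>2)) * c\<^sup>2 = (c\<^sup>2 / (4 * a * b))\<^sup>2"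
  proof -
    have c3: "c\<^sup>2 * c\<^sup>2 * c\<^sup>2 = (a + b) ^ 3 * (a - b) ^ 3" unfolding c_sq by algebra
    have "4 * ((a + b) ^ 3 / (8 * a * b * c\<^sup>2)) * ((a - b) ^ 3 / (8 * a * b * c\<^sup>2)) * c\<^sup>2 =
        ((a + b) ^ 3 * (a - b) ^ 3) * c\<^sup>2 / (16 * (a * b)\<^sup>2 * (c\<^sup>2 * c\<^sup>2))"
      by (simp add: power2_eq_square)
    also have "\<dots> = (c\<^sup>2 / (4 * a * b))\<^sup>2"
      unfolding c3[symmetric] using a_pos b_pos c_nz by (simp add: power2_eq_square)
    finally show ?thesis .
  qed
  also have "of_real ((c\<^sup>2 / (4 * a * b))\<^sup>2) * ?z\<^sup>2 = (of_real (c\<^sup>2 / (4 * a * b)) * ?z)\<^sup>2"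
    by (simp only: power_mult_distrib of_real_power)
  also have "of_real (c\<^sup>2 / (4 * a * b)) * ?z = w"
    unfolding w_def complex_eq_iff complex_Re_of_real_mult complex_Im_of_real_mult
    using a_pos b_pos by simp
  finally show "w\<^sup>2 = 4 * m * n" by simp
qed

lemma euler_locus_ellipse:
  "ellipse_foci_axes (euler_locus a b C r) C
    (a * \<xi> * ((1 + (b / a)\<^sup>2) / 2), b * \<eta> * ((1 + (a / b)\<^sup>2) / 2))
    (cmod m + cmod n) \<bar>cmod m - cmod n\<bar>"
  (is "ellipse_foci_axes _ _ ?F' _ _")
proof -
  have C: "C = ctr + (Re w, Im w)" and F': "?F' = ctr + (Re (- w), Im (- w))"
    unfolding C_def ctr_def w_def c_sq using a_pos b_pos
    by (simp_all add: field_simps power2_eq_square)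
  have d: "dist (ctr + (Re x, Im x)) (ctr + (Re y, Im y)) = cmod (x - y)" for x y
    by (simp add: dist_norm norm_prod_def cmod_def power2_eq_square)
  have "cmod w ^ 2 = cmod (4 * m * n)" unfolding w_sq[symmetric] norm_power ..
  then have w2: "(cmod w)\<^sup>2 = 4 * cmod m * cmod n" by (simp add: norm_mult)
  \<comment> \<open>This keeps the major axis positive even if \<open>m\<close> vanishes.\<close>
  have "cmod n > 0"
    unfolding cmod_n using a_pos b_pos b_less_a c_sq_pos U_pos V_pos by (simp add: add_pos_pos)
  then have "0 < cmod m + cmod n" by (simp add: add_nonneg_pos)
  moreover have "(cmod m + cmod n)\<^sup>2 = \<bar>cmod m - cmod n\<bar>\<^sup>2 + (dist C ?F' / 2)\<^sup>2"
  proof -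
    have "dist C ?F' = 2 * cmod w" unfolding C F' d by (simp flip: mult_2 add: norm_mult)
    then show ?thesis using w2 by (simp add: power2_eq_square algebra_simps)
  qed
  moreover have "euler_locus a b C r = {P. dist P C + dist P ?F' = 2 * (cmod m + cmod n)}"
  proof (rule set_eqI)
    fix P
    define v where "v = Complex (fst (P - ctr)) (snd (P - ctr))"
    have P: "P = ctr + (Re v, Im v)" by (simp add: v_def prod_eq_iff)
    have "P \<in> euler_locus a b C r \<longleftrightarrow> (\<exists>l. cmod l = 1 \<and> v = m * l + n * cnj l)"
      unfolding euler_locus_eq P by (auto simp: complex_eq_iff)
    also have "\<dots> \<longleftrightarrow> cmod (v - w) + cmod (v + w) = 2 * (cmod m + cmod n)"
      using unit_circle_image_eq_ellipse[OF w_sq] by simp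
    also have "\<dots> \<longleftrightarrow> P \<in> {P. dist P C + dist P ?F' = 2 * (cmod m + cmod n)}"
      unfolding mem_Collect_eq P C F' d by simp
    finally show "P \<in> euler_locus a b C r \<longleftrightarrow> P \<in> {P. dist P C + dist P ?F' = 2 * (cmod m + cmod n)}" .
  qed
  ultimately show ?thesis unfolding ellipse_foci_axes_def by simp
qed

end

section \<open>Return to the original coordinates\<close>

theorem proposition7:
  fixes a b c xc yc r a5 b5 :: real
  assumes "0 < b" and "b < a" and "c\<^sup>2 = a\<^sup>2 - b\<^sup>2"
    and "xc\<^sup>2 / a\<^sup>2 + yc\<^sup>2 / b\<^sup>2 < 1"
    and "r = (b * sqrt (a ^ 4 - c\<^sup>2 * xc\<^sup>2) - a * sqrt (b ^ 4 + c\<^sup>2 * yc\<^sup>2)) / c\<^sup>2"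
    and "a5 = ((a ^ 5 + 3 * a ^ 3 * b\<^sup>2) * delta3 a b yc - (b ^ 5 + 3 * a\<^sup>2 * b ^ 3) * delta3' a b xc)
              / (a * b * c\<^sup>2)"
    and "b5 = \<bar>(3 * a ^ 3 + a * b\<^sup>2) * delta3 a b yc - (3 * b ^ 3 + a\<^sup>2 * b) * delta3' a b xc\<bar> / c\<^sup>2"
  shows "ellipse_foci_axes (euler_locus a b (xc, yc) r)
           (xc, yc)
           (xc * ((1 + (b / a)\<^sup>2) / 2), yc * ((1 + (a / b)\<^sup>2) / 2))
           a5 b5"
proof -
  have a: "0 < a" using assms(1,2) by simp
  define \<xi> where "\<xi> = xc / a"
  define \<eta> where "\<eta> = yc / b"
  have xc: "xc = a * \<xi>" and yc: "yc = b * \<eta>" using a assms(1) by (simp_all add: \<xi>_def \<eta>_def)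
  have in_disc: "\<xi>\<^sup>2 + \<eta>\<^sup>2 < 1" using assms(4) by (simp add: \<xi>_def \<eta>_def power_divide)
  define U where "U = sqrt (a\<^sup>2 - c\<^sup>2 * \<xi>\<^sup>2)"
  define V where "V = sqrt (b\<^sup>2 + c\<^sup>2 * \<eta>\<^sup>2)"
  have c_pos: "0 < c\<^sup>2" unfolding assms(3) using assms(1,2) by (simp add: power_strict_mono)
  have "c\<^sup>2 * \<xi>\<^sup>2 + c\<^sup>2 * \<eta>\<^sup>2 < c\<^sup>2" using in_disc c_pos
    by (metis distrib_left mult.right_neutral mult_less_cancel_left_pos)
  then have lt: "b\<^sup>2 + c\<^sup>2 * \<eta>\<^sup>2 < a\<^sup>2 - c\<^sup>2 * \<xi>\<^sup>2" using assms(3) by linarith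
  have V0: "0 < b\<^sup>2 + c\<^sup>2 * \<eta>\<^sup>2" using assms(1) by (simp add: add_pos_nonneg)
  have U_sq: "U\<^sup>2 = a\<^sup>2 - c\<^sup>2 * \<xi>\<^sup>2" and V_sq: "V\<^sup>2 = b\<^sup>2 + c\<^sup>2 * \<eta>\<^sup>2"
    using lt V0 by (simp_all add: U_def V_def)
  interpret poncelet a b c \<xi> \<eta> U V
  proof
    show "0 < V" "V < U" using lt V0 by (simp_all add: U_def V_def)
  qed (use assms U_sq V_sq in auto)
  have sU: "sqrt (a ^ 4 - c\<^sup>2 * xc\<^sup>2) = a * U"
  proof -
    have "a ^ 4 - c\<^sup>2 * xc\<^sup>2 = (a * U)\<^sup>2" unfolding xc power_mult_distrib U_sq by algebra
    then show ?thesis using a U_pos by simp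
  qed
  have sV: "sqrt (b ^ 4 + c\<^sup>2 * yc\<^sup>2) = b * V"
  proof -
    have "b ^ 4 + c\<^sup>2 * yc\<^sup>2 = (b * V)\<^sup>2" unfolding yc power_mult_distrib V_sq by algebra
    then show ?thesis using assms(1) V_pos by simp
  qed
  have r_eq: "r = local.r" unfolding assms(5) r_def sU sV by (simp add: algebra_simps)
  have d3: "delta3 a b yc = V / (4 * a)" "delta3' a b xc = U / (4 * b)"
    unfolding delta3_def delta3'_def assms(3)[symmetric] sU sV using a assms(1) by simp_all
  have a5: "a5 = cmod m + cmod n"
    unfolding assms(6) d3 cmod_m cmod_n using a assms(1) c_nz
    by (simp add: divide_simps) algebra
  \<comment> \<open>The signed semi-minor formula is exactly this difference, hence the absolute
    value in \<open>b5\<close>.\<close>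
  have "cmod m - cmod n =
      ((3 * a ^ 3 + a * b\<^sup>2) * delta3 a b yc - (3 * b ^ 3 + a\<^sup>2 * b) * delta3' a b xc) / c\<^sup>2"
    unfolding d3 cmod_m cmod_n using a assms(1) c_nz
    by (simp add: divide_simps) algebra
  then have b5: "b5 = \<bar>cmod m - cmod n\<bar>"
    unfolding assms(7) using c_pos by simp
  show ?thesis
    using euler_locus_ellipse unfolding a5 b5 r_eq C_def xc[symmetric] yc[symmetric] .
qed

end
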